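(* Let $k<0$ and $m>0$ be integers. Then $J_k^m$ is a finite-dimensional $\mathbb{C}$-vector space.
   Context: $\mathfrak{H}$ is the upper half-plane, $e(x)=\exp(2\pi ix)$, $q=e(\tau)$, $\zeta=e(z)$. For a lattice $L=[\omega_1,\omega_2]$, $\eta(\omega,L)$ for $\omega\in L$ is the quasi-period of the Weierstrass $\zeta$-function ($\zeta(z+\omega,L)=\zeta(z,L)+\eta(\omega,L)$), extended $\mathbb{R}$-linearly. $\psi(z,L)=-1$ if $z\in L-2L$, $1$ otherwise; $\psi(\lambda\ \mu):=\psi(\lambda\tau+\mu,[\tau,1])$. For integer $k$: $(\phi|'_kM)(\tau,z)=(c\tau+d)^{-k}\phi(\frac{a\tau+b}{c\tau+d},\frac{z}{c\tau+d})$ for $M=\begin{pmatrix}a&b\\c&d\end{pmatrix}$, and $(\phi|''_k[\lambda\ \mu])(\tau,z)=\big(\psi(\lambda\ \mu)\exp(\eta(\lambda\tau+\mu,[\tau,1])(z+\tfrac12(\lambda\tau+\mu)))\big)^k\phi(\tau,z+\lambda\tau+\mu)$. $\rho(\tau,z)=\exp(\tfrac12\eta(1,[\tau,1])z^2-\pi iz)$. $J_k:=J_k(\mathrm{SL}_2(\mathbb{Z}))$ is the space of holomorphic $\phi:\mathfrak{H}\times\mathbb{C}\to\mathbb{C}$ with (i) $\phi|'_kM=\phi$ for $M\in\mathrm{SL}_2(\mathbb{Z})$; (ii) $\phi|''_kX=\phi$ for $X\in\mathbb{Z}^2$; (iii) for each $M\in\mathrm{SL}_2(\mathbb{Z})$,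 $\rho^k(\phi|'_kM)=\sum_{n\ge0}\sum_{|r|\le r_0(n)}c(n,r)q^n\zeta^r$ for some increasing sequence of nonnegative integers $r_0(n)$ with $r_0(n)/n\to0$. For an integer $m>0$, $J_k^m$ is the subspace of $\phi\in J_k$ for which $\rho^k\phi=\sum_{n\ge0}\sum_{|r|\le r_0(n)}c(n,r)q^n\zeta^r$ (with $r_0$ as in (iii)) and $\min\{n-r_0(n):n\ge0\}+\frac{k}{8}\ge -m$.
   Formalization: The zero function is put into J_k^m explicitly: for k < -8m no function satisfies the inequality min{n-r_0(n)}+k/8 >= -m, so the set as literally defined would be empty; for k >= -8m nothing changes. "Increasing" r_0 is read as non-decreasing. *)

theory Defs
  imports "HOL-Analysis.Analysis" "HOL-Library.Function_Algebras"
begin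

definition e :: "complex \<Rightarrow> complex" where
  "e x = exp (2 * of_real pi * \<i> * x)"

definition upper_half_plane :: "complex set" where
  "upper_half_plane = {\<tau>. Im \<tau> > 0}"

definition lattice :: "complex \<Rightarrow> complex \<Rightarrow> complex set" where
  "lattice \<omega>1 \<omega>2 = {of_int a * \<omega>1 + of_int b * \<omega>2 | a b :: int. True}"

definition weierstrass_zeta :: "complex \<Rightarrow> complex set \<Rightarrow> complex" where
  "weierstrass_zeta z L = 1 / z + (\<Sum>\<^sub>\<infinity>\<omega>\<in>L - {0}. 1 / (z - \<omega>) + 1 / \<omega> + z / \<omega>\<^sup>2)"

text \<open>The quasi-period map, together with its extension from \<open>L\<close> to \<open>\<complex>\<close>: \<^const>\<open>linear\<close> is
  linearity over the reals, and a lattice spans \<open>\<complex>\<close> over the reals, so the map is unique.\<close>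

definition eta :: "complex \<Rightarrow> complex set \<Rightarrow> complex" where
  "eta w L = (THE f. linear f \<and>
     (\<forall>\<omega>\<in>L. \<forall>z. z \<notin> L \<longrightarrow> weierstrass_zeta (z + \<omega>) L = weierstrass_zeta z L + f \<omega>)) w"

definition psi :: "complex \<Rightarrow> complex set \<Rightarrow> complex" where
  "psi z L = (if z \<in> L - (\<lambda>w. 2 * w) ` L then - 1 else 1)"

definition SL2Z :: "(int^2^2) set" where
  "SL2Z = {M. det M = 1}"

definition slash_mat :: "(complex \<times> complex \<Rightarrow> complex) \<Rightarrow> int \<Rightarrow> int^2^2 \<Rightarrow> complex \<times> complex \<Rightarrow> complex" where
  "slash_mat \<phi> k M = (\<lambda>(\<tau>, z).
     let a = of_int (M $ 1 $ 1); b = of_int (M $ 1 $ 2);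
         c = of_int (M $ 2 $ 1); d = of_int (M $ 2 $ 2)
     in (c * \<tau> + d) powi (- k) * \<phi> ((a * \<tau> + b) / (c * \<tau> + d), z / (c * \<tau> + d)))"

definition slash_vec :: "(complex \<times> complex \<Rightarrow> complex) \<Rightarrow> int \<Rightarrow> int \<times> int \<Rightarrow> complex \<times> complex \<Rightarrow> complex" where
  "slash_vec \<phi> k X = (\<lambda>(\<tau>, z).
     let \<omega> = of_int (fst X) * \<tau> + of_int (snd X); L = lattice \<tau> 1
     in (psi \<omega> L * exp (eta \<omega> L * (z + \<omega> / 2))) powi k * \<phi> (\<tau>, z + \<omega>))"

definition rho :: "complex \<Rightarrow> complex \<Rightarrow> complex" where
  "rho \<tau> z = exp (eta 1 (lattice \<tau> 1) * z\<^sup>2 / 2 - of_real pi * \<i> * z)"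

text \<open>Holomorphy in two variables: complex differentiability at every point.\<close>

definition holomorphic2_on :: "(complex \<times> complex \<Rightarrow> complex) \<Rightarrow> (complex \<times> complex) set \<Rightarrow> bool" where
  "holomorphic2_on f S \<longleftrightarrow>
     (\<forall>p\<in>S. \<exists>a b. (f has_derivative (\<lambda>h. a * fst h + b * snd h)) (at p within S))"

text \<open>``Increasing'' has to be read as non-decreasing: a strictly increasing sequence of
  natural numbers satisfies \<open>r0 n \<ge> n\<close>.\<close>

definition admissible :: "(nat \<Rightarrow> nat) \<Rightarrow> bool" where
  "admissible r0 \<longleftrightarrow> incseq r0 \<and> (\<lambda>n. real (r0 n) / real n) \<longlonglongrightarrow> 0"

definition has_expansion :: "int \<Rightarrow> (complex \<times> complex \<Rightarrow> complex) \<Rightarrow> (nat \<Rightarrow> nat) \<Rightarrow> bool" where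
  "has_expansion k f r0 \<longleftrightarrow> (\<exists>c :: nat \<Rightarrow> int \<Rightarrow> complex. \<forall>\<tau>\<in>upper_half_plane. \<forall>z.
     (\<lambda>n. \<Sum>r = - int (r0 n)..int (r0 n). c n r * e \<tau> ^ n * e z powi r)
       sums (rho \<tau> z powi k * f (\<tau>, z)))"

text \<open>Functions on the product of the upper half-plane and \<open>\<complex>\<close> are represented by total functions
  that vanish off this set, so that equality of functions is equality on the domain.\<close>

definition J_space :: "int \<Rightarrow> (complex \<times> complex \<Rightarrow> complex) set" where
  "J_space k = {\<phi>.
     (\<forall>p. p \<notin> upper_half_plane \<times> UNIV \<longrightarrow> \<phi> p = 0) \<and>
     holomorphic2_on \<phi> (upper_half_plane \<times> UNIV) \<and>
     (\<forall>M\<in>SL2Z. \<forall>p\<in>upper_half_plane \<times> UNIV. slash_mat \<phi> k M p = \<phi> p) \<and>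
     (\<forall>X. \<forall>p\<in>upper_half_plane \<times> UNIV. slash_vec \<phi> k X p = \<phi> p) \<and>
     (\<forall>M\<in>SL2Z. \<exists>r0. admissible r0 \<and> has_expansion k (slash_mat \<phi> k M) r0)}"

text \<open>The infimum below is attained. The zero function is included
  explicitly: every \<open>r0\<close> gives a minimum \<open>\<le> 0\<close>, so for \<open>k < - 8 * m\<close> no function at all satisfies
  the inequality, and the subspace meant is then \<open>{0}\<close>. For \<open>k \<ge> - 8 * m\<close> the zero
  function satisfies it with \<open>r0 = 0\<close>, and the disjunct changes nothing.\<close>

definition J_space_bounded :: "int \<Rightarrow> int \<Rightarrow> (complex \<times> complex \<Rightarrow> complex) set" where
  "J_space_bounded k m = {\<phi> \<in> J_space k. \<phi> = 0 \<or>
     (\<exists>r0. admissible r0 \<and> has_expansion k \<phi> r0 \<and>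
        real_of_int (INF n. int n - int (r0 n)) + real_of_int k / 8 \<ge> - real_of_int m)}"

lemma admissible_INF_attained:
  assumes "admissible r0"
  shows "bdd_below (range (\<lambda>n. int n - int (r0 n)))"
    and "(INF n. int n - int (r0 n)) \<in> range (\<lambda>n. int n - int (r0 n))"
proof -
  have "eventually (\<lambda>n. real (r0 n) / real n < 1) sequentially"
    using assms unfolding admissible_def by (auto intro: order_tendstoD(2)[where a = 1])
  then obtain N where N: "\<And>n. n \<ge> N \<Longrightarrow> real (r0 n) / real n < 1"
    by (auto simp: eventually_sequentially)
  have "int n - int (r0 n) \<ge> - int (r0 N)" for n
  proof (cases "n \<ge> Suc N")
    case True
    then have "real (r0 n) < real n"
      using N[of n] by (simp add: divide_simps)
    then show ?thesis by simp
  next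
    case False
    then have "r0 n \<le> r0 N"
      using assms by (auto simp: admissible_def intro: incseqD)
    then show ?thesis by simp
  qed
  then show bdd: "bdd_below (range (\<lambda>n. int n - int (r0 n)))"
    by (intro bdd_belowI2)
  let ?X = "range (\<lambda>n. int n - int (r0 n))"
  obtain x where x: "x \<in> ?X" "x < Inf ?X + 1"
    using cInf_lessD[of ?X "Inf ?X + 1"] by auto
  moreover have "Inf ?X \<le> x"
    using x bdd by (intro cInf_lower)
  ultimately show "Inf ?X \<in> ?X"
    by (metis zle_add1_eq_le order_antisym)
qed

definition fun_scale :: "complex \<Rightarrow> ('a \<Rightarrow> complex) \<Rightarrow> 'a \<Rightarrow> complex" where
  "fun_scale c f = (\<lambda>x. c * f x)"

global_interpretation cfun: vector_space "fun_scale :: complex \<Rightarrow> ('a \<Rightarrow> complex) \<Rightarrow> 'a \<Rightarrow> complex"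
  by unfold_locales (auto simp: fun_scale_def algebra_simps)

end

theory Submission
  imports Defs "HOL-Complex_Analysis.Complex_Analysis"
begin

text \<open>Put \<open>K = - k > 0\<close>. For fixed \<open>\<tau>\<close>, the function \<open>F = \<rho>\<^sup>k \<phi>\<close> satisfies \<open>F (z + 1) = F z\<close> and, by the Legendre
  relation, \<open>F (z + \<tau>) = (- e (- z)) ^ K * F z\<close>, exactly like the \<open>K\<close>-th power of the theta product, which has
  simple zeros precisely at the lattice points. So if \<open>\<phi>(\<tau>, \<cdot>)\<close> vanishes to order greater than \<open>K\<close> at \<open>0\<close>, the
  quotient is an entire elliptic function that vanishes at \<open>0\<close>, and \<open>\<phi>(\<tau>, \<cdot>) = 0\<close>.

  On the other hand the \<open>j\<close>-th Taylor coefficient of \<open>\<phi>\<close> at \<open>z = 0\<close> has weight \<open>j - K\<close>, and the first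
  nonvanishing one is a power series in \<open>q\<close>, since it coincides with that of \<open>F\<close>. Modular forms of negative weight are
  zero and those of weight \<open>0\<close> are constant, so \<open>\<phi>\<close> vanishes to order at least \<open>K\<close> and is determined by one
  complex number, the \<open>K\<close>-th coefficient. The whole space \<open>J\<^sub>k\<close> therefore has dimension at most \<open>1\<close>.\<close>

section \<open>The lattice and elliptic functions\<close>

text \<open>Two obstacles shape the proof. The first is the Legendre relation. The quasi-periods
  enter the slash action through a definite description, so existence and uniqueness of the
  quasi-period map must be drawn from the zeta series itself. A comparison of zeta with the
  logarithmic derivative of the theta product then replaces the usual contour integral, so one
  product serves twice.

  The second is the dependence of \<open>rho\<close> on \<tau>. The expansion condition concerns
  \<open>F\<close>, not \<phi>, and its coefficients of q^n are functions of z. They are bounded by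
  Cauchy's inequality in q, uniformly in z, and the series is differentiated in z only. For this it
  suffices that \<open>F\<close> is bounded while \<tau> runs through a horizontal segment, hence
  that eta(1, [\<tau>, 1]) is bounded there; a majorant of the zeta series whose constants depend on
  \<tau> only through \<open>lattice_const\<close> gives this.

  For the modular forms, a shortest lattice vector moves \<tau> to a point with imaginary part at
  least 1/2, and this crude reduction takes the place of a fundamental domain.\<close>

lemma e_add: "e (x + y) = e x * e y"
  by (simp add: e_def exp_add algebra_simps)

lemma e_eq_1_iff: "e z = 1 \<longleftrightarrow> (\<exists>n::int. z = of_int n)"
proof -
  have "e z = 1 \<longleftrightarrow> (\<exists>n::int. 2 * of_real pi * \<i> * z = 2 * of_real pi * \<i> * of_int n)"
    unfolding e_def exp_eq_1 by (auto simp: complex_eq_iff algebra_simps)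
  then show ?thesis by simp
qed

lemma e_of_int [simp]: "e (of_int n) = 1"
  by (auto simp: e_eq_1_iff)

lemma e_nonzero [simp]: "e z \<noteq> 0"
  by (simp add: e_def)

lemma e_0 [simp]: "e 0 = 1"
  by (simp add: e_def)

lemma e_1 [simp]: "e 1 = 1"
  using e_of_int[of 1] by simp

lemma e_minus: "e (- z) = inverse (e z)"
  by (simp add: e_def exp_minus)

lemma e_power: "e z ^ n = e (of_nat n * z)"
  by (simp add: e_def exp_of_nat_mult[symmetric] algebra_simps)

lemma norm_e: "norm (e z) = exp (- 2 * pi * Im z)"
  by (simp add: e_def)

lemma norm_e_less_1: "\<tau> \<in> upper_half_plane \<Longrightarrow> norm (e \<tau>) < 1"
  by (simp add: norm_e upper_half_plane_def)

lemma e_holomorphic [holomorphic_intros]: "f holomorphic_on S \<Longrightarrow> (\<lambda>z. e (f z)) holomorphic_on S"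
  unfolding e_def by (intro holomorphic_intros)

text \<open>An explicit function of \<tau> instead of an existential constant: it is bounded on
  horizontal segments, which later makes the bound on the quasi-period uniform in \<tau>.\<close>

definition lattice_const :: "complex \<Rightarrow> real" where
  "lattice_const \<tau> = 1 + (1 + norm \<tau>) / Im \<tau>"

text \<open>The imaginary part controls \<open>x\<close>, and then \<open>y\<close> is a difference.
  The coordinates are real because the bound is also applied to lattice points shifted by
  1/2.\<close>

lemma lattice_coords_bound:
  assumes "\<tau> \<in> upper_half_plane"
  shows "\<bar>x\<bar> + \<bar>y\<bar> \<le> lattice_const \<tau> * norm (of_real x * \<tau> + of_real y)"
proof -
  let ?w = "of_real x * \<tau> + of_real y"
  have pos: "Im \<tau> > 0" using assms by (simp add: upper_half_plane_def)
  have "\<bar>x\<bar> * Im \<tau> = \<bar>Im ?w\<bar>" using pos by (simp add: abs_mult)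
  also have "\<dots> \<le> norm ?w" by (rule abs_Im_le_cmod)
  finally have x: "\<bar>x\<bar> \<le> norm ?w / Im \<tau>" using pos by (simp add: field_simps)
  have "\<bar>y\<bar> = norm (?w - of_real x * \<tau>)" by simp
  also have "\<dots> \<le> norm ?w + \<bar>x\<bar> * norm \<tau>"
    using norm_triangle_ineq4[of ?w "of_real x * \<tau>"] by (simp add: norm_mult)
  also have "\<dots> \<le> norm ?w + norm ?w / Im \<tau> * norm \<tau>"
    using x by (intro add_left_mono mult_right_mono) auto
  finally have "\<bar>x\<bar> + \<bar>y\<bar> \<le> norm ?w / Im \<tau> + (norm ?w + norm ?w / Im \<tau> * norm \<tau>)"
    using x by linarith
  also have "\<dots> = lattice_const \<tau> * norm ?w"
    using pos by (simp add: lattice_const_def field_simps)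
  finally show ?thesis .
qed

lemma lattice_const_pos: "\<tau> \<in> upper_half_plane \<Longrightarrow> lattice_const \<tau> > 0"
  by (auto simp: lattice_const_def upper_half_plane_def intro!: add_pos_nonneg divide_nonneg_pos)

lemma lattice_iff: "z \<in> lattice \<tau> 1 \<longleftrightarrow> (\<exists>a b::int. z = of_int a * \<tau> + of_int b)"
  by (simp add: lattice_def)

lemma zero_in_lattice [simp]: "0 \<in> lattice \<tau> 1"
  unfolding lattice_iff by (rule exI[of _ 0], rule exI[of _ 0]) simp

lemma one_in_lattice [simp]: "1 \<in> lattice \<tau> 1"
  unfolding lattice_iff by (rule exI[of _ 0], rule exI[of _ 1]) simp

lemma tau_in_lattice [simp]: "\<tau> \<in> lattice \<tau> 1"
  unfolding lattice_iff by (rule exI[of _ 1], rule exI[of _ 0]) simp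

lemma lattice_add: "x \<in> lattice \<tau> 1 \<Longrightarrow> y \<in> lattice \<tau> 1 \<Longrightarrow> x + y \<in> lattice \<tau> 1"
  unfolding lattice_iff
proof clarify
  fix a b c d :: int
  show "\<exists>a' b'. of_int a * \<tau> + of_int b + (of_int c * \<tau> + of_int d) = of_int a' * \<tau> + of_int b'"
    by (rule exI[of _ "a + c"], rule exI[of _ "b + d"]) (simp add: algebra_simps)
qed

lemma lattice_minus: "x \<in> lattice \<tau> 1 \<Longrightarrow> - x \<in> lattice \<tau> 1"
  unfolding lattice_iff
proof clarify
  fix a b :: int
  show "\<exists>a' b'. - (of_int a * \<tau> + of_int b) = of_int a' * \<tau> + of_int b'"
    by (rule exI[of _ "- a"], rule exI[of _ "- b"]) (simp add: algebra_simps)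
qed

lemma lattice_add_iff: "y \<in> lattice \<tau> 1 \<Longrightarrow> x + y \<in> lattice \<tau> 1 \<longleftrightarrow> x \<in> lattice \<tau> 1"
  using lattice_add[of x \<tau> y] lattice_add[of "x + y" \<tau> "- y"] lattice_minus[of y \<tau>] by auto

lemma lattice_separated:
  assumes "\<tau> \<in> upper_half_plane" "w \<in> lattice \<tau> 1" "w \<noteq> 0"
  shows "1 / lattice_const \<tau> \<le> norm w"
proof -
  from assms(2) obtain a b :: int where w: "w = of_int a * \<tau> + of_int b"
    by (auto simp: lattice_iff)
  have "a \<noteq> 0 \<or> b \<noteq> 0" using w assms(3) by auto
  then have "1 \<le> \<bar>a\<bar> + \<bar>b\<bar>" by linarith
  then have "1 \<le> \<bar>real_of_int a\<bar> + \<bar>real_of_int b\<bar>" by linarith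
  also have "\<dots> \<le> lattice_const \<tau> * norm w"
    using lattice_coords_bound[OF assms(1), of "real_of_int a" "real_of_int b"] w by simp
  finally show ?thesis
    using lattice_const_pos[OF assms(1)] by (simp add: field_simps)
qed

lemma closed_lattice:
  assumes "\<tau> \<in> upper_half_plane"
  shows "closed (lattice \<tau> 1)"
proof (rule discrete_imp_closed)
  show "0 < 1 / lattice_const \<tau>" using lattice_const_pos[OF assms] by simp
  show "\<forall>x\<in>lattice \<tau> 1. \<forall>y\<in>lattice \<tau> 1. dist y x < 1 / lattice_const \<tau> \<longrightarrow> y = x"
  proof (intro ballI impI)
    fix x y assume xy: "x \<in> lattice \<tau> 1" "y \<in> lattice \<tau> 1" "dist y x < 1 / lattice_const \<tau>"
    then have "y - x \<in> lattice \<tau> 1" using lattice_add[OF xy(2) lattice_minus[OF xy(1)]] by simp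
    then show "y = x" using lattice_separated[OF assms, of "y - x"] xy(3) by (force simp: dist_norm)
  qed
qed

lemma lattice_inter_ball:
  assumes "\<tau> \<in> upper_half_plane" "w \<in> lattice \<tau> 1" "w \<in> ball 0 (1 / lattice_const \<tau>)"
  shows "w = 0"
  using lattice_separated[OF assms(1,2)] assms(3) by force

lemma lattice_reduce:
  assumes "\<tau> \<in> upper_half_plane"
  obtains w where "w \<in> lattice \<tau> 1" "norm (z - w) \<le> norm \<tau> + 1"
proof -
  have pos: "Im \<tau> > 0" using assms by (simp add: upper_half_plane_def)
  define x where "x = Im z / Im \<tau>"
  define y where "y = Re z - x * Re \<tau>"
  have z: "z = of_real x * \<tau> + of_real y"
    using pos by (simp add: complex_eq_iff x_def y_def)
  define w where "w = of_int \<lfloor>x\<rfloor> * \<tau> + of_int \<lfloor>y\<rfloor>"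
  have "z - w = of_real (frac x) * \<tau> + of_real (frac y)"
    by (simp add: z w_def frac_def algebra_simps)
  also have "norm \<dots> \<le> frac x * norm \<tau> + frac y"
    by (rule order.trans[OF norm_triangle_ineq]) (simp add: norm_mult)
  also have "\<dots> \<le> 1 * norm \<tau> + 1"
    by (intro add_mono mult_right_mono) (auto intro: less_imp_le frac_lt_1)
  finally show ?thesis using that[of w] by (auto simp: w_def lattice_iff)
qed

section \<open>Periodic functions and Liouville's theorem\<close>

lemma lattice_periodic:
  assumes "\<And>z. f (z + 1) = f z" "\<And>z. f (z + \<tau>) = f z" "w \<in> lattice \<tau> 1"
  shows "f (z + w) = f z"
proof -
  have int_mult: "f (z + of_int n * p) = f z" if p: "\<And>z. f (z + p) = f z" for n :: int and p z
  proof (induction n rule: int_induct[where k = 0])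
    case (step1 i) then show ?case using p[of "z + of_int i * p"] by (simp add: algebra_simps)
  next
    case (step2 i) then show ?case using p[of "z + of_int (i - 1) * p"] by (simp add: algebra_simps)
  qed auto
  obtain a b :: int where w: "w = of_int a * \<tau> + of_int b" using assms(3) by (auto simp: lattice_iff)
  show ?thesis
    using int_mult[OF assms(1), of "z + of_int a * \<tau>" b] int_mult[OF assms(2), of z a]
    by (simp add: w add.assoc)
qed

text \<open>Liouville's theorem: one limit at 0 suffices, because periodicity carries the removable
  singularity from 0 to every lattice point. The hypotheses stay off the lattice since the functions
  in question are built from quotients whose values at lattice points carry no meaning.\<close>

lemma elliptic_const:
  assumes tau: "\<tau> \<in> upper_half_plane"
    and holo: "h holomorphic_on - lattice \<tau> 1"
    and per: "\<And>z. z \<notin> lattice \<tau> 1 \<Longrightarrow> h (z + 1) = h z" "\<And>z. z \<notin> lattice \<tau> 1 \<Longrightarrow> h (z + \<tau>) = h z"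
    and lim: "(h \<longlongrightarrow> l) (at 0)"
    and z: "z \<notin> lattice \<tau> 1"
  shows "h z = l"
proof -
  let ?L = "lattice \<tau> 1"
  define H where "H = (\<lambda>z. if z \<in> ?L then l else h z)"
  have H_per: "H (z + 1) = H z" "H (z + \<tau>) = H z" for z
    using per[of z] by (auto simp: H_def lattice_add_iff)
  have H_per': "H (z + w) = H z" if "w \<in> ?L" for z w
    by (rule lattice_periodic[of H \<tau> w]) (use H_per that in auto)
  define d where "d = 1 / lattice_const \<tau>"
  have d: "d > 0" using lattice_const_pos[OF tau] by (simp add: d_def)
  have H_hol: "H holomorphic_on - ?L"
    using holo by (rule holomorphic_transform) (auto simp: H_def)
  have "H holomorphic_on ball 0 d"
  proof (rule no_isolated_singularity'[of "{0}"])
    have ev: "eventually (\<lambda>z. h z = H z) (at 0)"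
      unfolding eventually_at using d lattice_inter_ball[OF tau]
      by (intro exI[of _ d]) (auto simp: H_def d_def)
    have "(H \<longlongrightarrow> H 0) (at 0)"
      using Lim_transform_eventually[OF lim ev] by (simp add: H_def)
    then show "(H \<longlongrightarrow> H z) (at z within ball 0 d)" if "z \<in> {0}" for z
      using that by (auto intro: tendsto_within_subset)
    show "H holomorphic_on ball 0 d - {0}"
      by (rule holomorphic_on_subset[OF H_hol]) (use lattice_inter_ball[OF tau] in \<open>auto simp: d_def\<close>)
  qed auto
  then have H0: "H field_differentiable at 0"
    using d by (auto simp: holomorphic_on_open field_differentiable_def)
  have "H field_differentiable at z" for z
  proof (cases "z \<in> ?L")
    case True
    have "H = H \<circ> (\<lambda>x. x - z)" 
      using H_per'[OF lattice_minus[OF True]] by (auto simp: fun_eq_iff)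
    moreover have "(H \<circ> (\<lambda>x. x - z)) field_differentiable at z"
      by (rule field_differentiable_compose) (use H0 in \<open>auto intro!: derivative_intros\<close>)
    ultimately show ?thesis by simp
  next
    case False
    then show ?thesis
      using H_hol closed_lattice[OF tau] 
      by (auto simp: holomorphic_on_open open_Compl field_differentiable_def)
  qed
  then have entire: "H holomorphic_on UNIV"
    by (auto simp: holomorphic_on_def field_differentiable_at_within)
  \<comment> \<open>Every value is already taken on a compact ball, by reduction modulo the
    lattice.\<close>
  have "range H \<subseteq> H ` cball 0 (norm \<tau> + 1)"
  proof clarify
    fix z
    obtain w where w: "w \<in> ?L" "norm (z - w) \<le> norm \<tau> + 1" using lattice_reduce[OF tau] .
    have "H z = H (z - w)" using H_per'[OF lattice_minus[OF w(1)], of z] by simp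
    then show "H z \<in> H ` cball 0 (norm \<tau> + 1)" using w(2) by auto
  qed
  moreover have "compact (H ` cball 0 (norm \<tau> + 1))"
    using entire by (intro compact_continuous_image)
      (auto intro: holomorphic_on_imp_continuous_on holomorphic_on_subset)
  ultimately have "bounded (range H)"
    by (meson bounded_subset compact_imp_bounded)
  then have "H constant_on UNIV" using Liouville_theorem[OF entire] by simp
  then have "H z = H 0" unfolding constant_on_def by auto
  then show ?thesis using z by (simp add: H_def)
qed

section \<open>The theta product\<close>

text \<open>The q-Pochhammer symbol (w; q)_infinity.\<close>

definition qprod :: "complex \<Rightarrow> complex \<Rightarrow> complex" where
  "qprod q w = (\<Prod>n. 1 - q ^ n * w)"

lemma convergent_qprod:
  fixes q w :: complex
  assumes "norm q < 1"
  shows "convergent_prod (\<lambda>n. 1 - q ^ n * w)"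
proof (rule abs_convergent_prod_imp_convergent_prod, rule summable_imp_abs_convergent_prod)
  show "summable (\<lambda>i. norm (1 - q ^ i * w - 1))"
    using summable_mult2[OF summable_geometric[of "norm q"], of "norm w"] assms
    by (simp add: norm_mult norm_power)
qed

lemma qprod_step:
  assumes "norm q < 1"
  shows "qprod q w = (1 - w) * qprod q (q * w)"
proof -
  have "(\<lambda>n. 1 - q ^ n * w) has_prod ((\<Prod>k<1. 1 - q ^ k * w) * (\<Prod>k. 1 - q ^ (k + 1) * w))"
    by (rule has_prod_ignore_initial_segment'[OF convergent_qprod[OF assms]])
  then have "qprod q w = (\<Prod>k<1. 1 - q ^ k * w) * (\<Prod>k. 1 - q ^ (k + 1) * w)"
    unfolding qprod_def using has_prod_unique by metis
  then show ?thesis by (simp add: qprod_def mult_ac)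
qed

lemma qprod_nonzero:
  assumes "norm q < 1" "\<And>n. q ^ n * w \<noteq> 1"
  shows "qprod q w \<noteq> 0"
  unfolding qprod_def by (rule prodinf_nonzero[OF convergent_qprod[OF assms(1)]]) (use assms(2) in auto)

lemma qprod_holomorphic:
  assumes "norm q < 1"
  shows "qprod q holomorphic_on UNIV"
proof (rule holomorphic_uniform_sequence)
  fix z :: complex
  let ?P = "\<lambda>n w. \<Prod>k<n. 1 - q ^ k * w"
  let ?f = "\<lambda>n w. - (q ^ n * w)"
  have "uniformly_convergent_on (cball z 1) (\<lambda>N x. \<Sum>n<N. norm (?f n x))"
  proof (rule Weierstrass_m_test'_ev)
    show "\<forall>\<^sub>F n in sequentially. \<forall>x\<in>cball z 1. norm (norm (?f n x)) \<le> norm q ^ n * (norm z + 1)"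
    proof (intro always_eventually allI ballI)
      fix n x assume "x \<in> cball z 1"
      then have "norm x \<le> norm z + 1"
        using norm_triangle_ineq2[of x z] by (simp add: dist_norm norm_minus_commute)
      then show "norm (norm (?f n x)) \<le> norm q ^ n * (norm z + 1)"
        by (simp add: norm_mult norm_power mult_left_mono)
    qed
    show "summable (\<lambda>n. norm q ^ n * (norm z + 1))"
      using assms by (intro summable_mult2 summable_geometric) auto
  qed
  then have "uniformly_convergent_on (cball z 1) (\<lambda>N x. \<Prod>n<N. 1 + ?f n x)"
    by (intro uniformly_convergent_on_prod) (auto intro!: continuous_intros)
  then obtain g where g: "uniform_limit (cball z 1) ?P g sequentially"
    by (auto simp: uniformly_convergent_on_def)
  have "g w = qprod q w" if "w \<in> cball z 1" for w
  proof (rule LIMSEQ_unique)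
    show "(\<lambda>n. ?P n w) \<longlonglongrightarrow> g w" using tendsto_uniform_limitI[OF g that] .
    show "(\<lambda>n. ?P n w) \<longlonglongrightarrow> qprod q w"
      unfolding qprod_def
      by (rule has_prod_imp_tendsto') (rule convergent_prod_has_prod[OF convergent_qprod[OF assms]])
  qed
  then have "uniform_limit (cball z 1) ?P (qprod q) sequentially"
    using g by (subst uniform_limit_cong'[where g = ?P and i = g]) auto
  then show "\<exists>d>0. cball z d \<subseteq> UNIV \<and> uniform_limit (cball z d) ?P (qprod q) sequentially"
    by (intro exI[of _ 1]) auto
qed (auto intro!: holomorphic_intros)

text \<open>The Jacobi theta function in product form, without the constant (q; q)_infinity and the
  exponential prefactor: only zeros and multipliers matter. The second product starts at q/\<zeta>
  instead of 1/\<zeta>, which keeps the zero at z = 0 simple.\<close>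

definition theta :: "complex \<Rightarrow> complex \<Rightarrow> complex" where
  "theta \<tau> z = qprod (e \<tau>) (e z) * qprod (e \<tau>) (e \<tau> * e (- z))"

lemma theta_add_1: "theta \<tau> (z + 1) = theta \<tau> z"
proof -
  have "e (- 1) = 1" using e_of_int[of "-1"] by simp
  then have "e (z + 1) = e z" "e (- (z + 1)) = e (- z)"
    using e_add[of z 1] e_add[of "- z" "- 1"] by simp_all
  then show ?thesis by (simp add: theta_def)
qed

text \<open>The shift takes the factor \<open>1 - e z\<close> out of the first product and puts
  \<open>1 - e (- z)\<close> into the second; the quotient of the two is
  \<open>- e (- z)\<close>.\<close>

lemma theta_add_tau:
  assumes "\<tau> \<in> upper_half_plane"
  shows "theta \<tau> (z + \<tau>) = - e (- z) * theta \<tau> z"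
proof -
  let ?q = "e \<tau>" and ?w = "e z"
  note q = norm_e_less_1[OF assms]
  have 1: "e (z + \<tau>) = ?q * ?w" by (simp add: e_add)
  have 2: "?q * e (- (z + \<tau>)) = e (- z)"
    by (simp only: e_minus e_add) (simp add: field_simps)
  have "theta \<tau> (z + \<tau>) = qprod ?q (?q * ?w) * qprod ?q (e (- z))"
    unfolding theta_def 1 2 ..
  also have "\<dots> = (1 - e (- z)) * qprod ?q (?q * ?w) * qprod ?q (?q * e (- z))"
    by (subst (2) qprod_step[OF q]) simp
  also have "1 - e (- z) = - e (- z) * (1 - ?w)"
    by (simp add: e_minus algebra_simps)
  also have "\<dots> * qprod ?q (?q * ?w) = - e (- z) * qprod ?q ?w"
    by (subst (2) qprod_step[OF q]) simp
  finally show ?thesis by (simp add: theta_def)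
qed

lemma theta_holomorphic:
  assumes "\<tau> \<in> upper_half_plane"
  shows "theta \<tau> holomorphic_on S"
proof -
  note q = qprod_holomorphic[OF norm_e_less_1[OF assms]]
  have "(qprod (e \<tau>) \<circ> e) holomorphic_on S"
    by (rule holomorphic_on_compose_gen[OF _ q]) (auto intro!: holomorphic_intros)
  moreover have "(qprod (e \<tau>) \<circ> (\<lambda>z. e \<tau> * e (- z))) holomorphic_on S"
    by (rule holomorphic_on_compose_gen[OF _ q]) (auto intro!: holomorphic_intros)
  ultimately show ?thesis
    unfolding theta_def[abs_def] o_def by (rule holomorphic_on_mult)
qed

lemma theta_nonzero:
  assumes "\<tau> \<in> upper_half_plane" "z \<notin> lattice \<tau> 1"
  shows "theta \<tau> z \<noteq> 0"
proof -
  have "e \<tau> ^ n * e z \<noteq> 1" for n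
  proof
    assume "e \<tau> ^ n * e z = 1"
    then have "e (of_nat n * \<tau> + z) = 1" by (simp add: e_power e_add)
    then obtain m :: int where "of_nat n * \<tau> + z = of_int m" by (auto simp: e_eq_1_iff)
    then have "z = of_int (- int n) * \<tau> + of_int m" by (simp add: algebra_simps eq_diff_eq)
    then show False using assms(2) unfolding lattice_iff by blast
  qed
  moreover have "e \<tau> ^ n * (e \<tau> * e (- z)) \<noteq> 1" for n
  proof
    assume "e \<tau> ^ n * (e \<tau> * e (- z)) = 1"
    then have "e (of_nat n * \<tau> + (\<tau> + - z)) = 1" by (simp only: e_power e_add)
    then obtain m :: int where "of_nat n * \<tau> + (\<tau> + - z) = of_int m" by (auto simp: e_eq_1_iff)
    then have "z = of_int (int n + 1) * \<tau> + of_int (- m)"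
      by (simp add: algebra_simps)
    then show False using assms(2) unfolding lattice_iff by blast
  qed
  ultimately show ?thesis
    unfolding theta_def using qprod_nonzero[OF norm_e_less_1[OF assms(1)]] by simp
qed

lemma qprod_e_nonzero:
  assumes "\<tau> \<in> upper_half_plane"
  shows "qprod (e \<tau>) (e \<tau>) \<noteq> 0"
proof (rule qprod_nonzero[OF norm_e_less_1[OF assms]])
  fix n
  have "norm (e \<tau> ^ n * e \<tau>) < 1"
    using norm_e_less_1[OF assms] power_Suc_less_one[of "norm (e \<tau>)" n]
    by (simp add: norm_mult norm_power mult.commute)
  then show "e \<tau> ^ n * e \<tau> \<noteq> 1" by auto
qed

text \<open>The factor \<open>1 - e z\<close> carries the zero, and the remaining factors do not
  vanish at 0. Having \<open>T\<close> as an entire function allows the zero of theta to be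
  cancelled explicitly, once against the pole of zeta and once against a zero of \<phi>.\<close>

lemma theta_simple_zero:
  assumes "\<tau> \<in> upper_half_plane"
  obtains T where "T holomorphic_on UNIV" "T 0 \<noteq> 0" "\<And>z. theta \<tau> z = z * T z"
proof -
  let ?q = "e \<tau>"
  note q = norm_e_less_1[OF assms]
  define T1 where "T1 = (\<lambda>z. if z = 0 then deriv e 0 else (e z - e 0) / (z - 0))"
  define T where "T = (\<lambda>z. - T1 z * (qprod ?q (?q * e z) * qprod ?q (?q * e (- z))))"
  have "(e has_field_derivative 2 * of_real pi * \<i>) (at 0)"
    unfolding e_def[abs_def] by (auto intro!: derivative_eq_intros)
  then have T1_0: "T1 0 \<noteq> 0" by (simp add: T1_def DERIV_imp_deriv)
  have "e holomorphic_on UNIV" using e_holomorphic[OF holomorphic_on_ident] by simp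
  then have T1: "T1 holomorphic_on UNIV"
    unfolding T1_def by (rule pole_lemma) simp
  have q1: "(qprod ?q \<circ> (\<lambda>z. ?q * e z)) holomorphic_on UNIV"
    by (rule holomorphic_on_compose_gen[OF _ qprod_holomorphic[OF q]]) (auto intro!: holomorphic_intros)
  have q2: "(qprod ?q \<circ> (\<lambda>z. ?q * e (- z))) holomorphic_on UNIV"
    by (rule holomorphic_on_compose_gen[OF _ qprod_holomorphic[OF q]]) (auto intro!: holomorphic_intros)
  have "T holomorphic_on UNIV"
    unfolding T_def using T1 q1 q2 by (intro holomorphic_intros) (auto simp: o_def)
  moreover have "T 0 \<noteq> 0" using T1_0 qprod_e_nonzero[OF assms] by (simp add: T_def)
  moreover have "theta \<tau> z = z * T z" for z
  proof -
    have "z * T1 z = e z - 1" by (simp add: T1_def)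
    moreover have "z * T z = - (z * T1 z) * (qprod ?q (?q * e z) * qprod ?q (?q * e (- z)))"
      by (simp add: T_def)
    ultimately have "z * T z = (1 - e z) * (qprod ?q (?q * e z) * qprod ?q (?q * e (- z)))"
      by simp
    then show ?thesis unfolding theta_def by (subst qprod_step[OF q]) simp
  qed
  ultimately show ?thesis using that by blast
qed

section \<open>Quasi-periods and the Legendre relation\<close>

definition lat_pt :: "complex \<Rightarrow> int \<times> int \<Rightarrow> complex" where
  "lat_pt \<tau> p = of_int (fst p) * \<tau> + of_int (snd p)"

text \<open>A size on the index set that does not depend on \<tau>, so that a single convergent
  series majorises the zeta series for all \<tau>. The summand 1 keeps it positive at the
  origin.\<close>

definition height :: "int \<times> int \<Rightarrow> real" where
  "height p = 1 + \<bar>real_of_int (fst p)\<bar> + \<bar>real_of_int (snd p)\<bar>"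

text \<open>Since division by 0 yields 0, the value at \<open>w = 0\<close> is \<open>1 / z\<close>,
  which is exactly the polar term of zeta.\<close>

definition zeta_term :: "complex \<Rightarrow> complex \<Rightarrow> complex" where
  "zeta_term z w = 1 / (z - w) + 1 / w + z / w\<^sup>2"

section \<open>Convergence of lattice sums\<close>

lemma height_ge_1: "height p \<ge> 1"
  by (simp add: height_def)

text \<open>The exponent 3/2 is half of the exponent 3 of the lattice sum and still exceeds
  1.\<close>

lemma summable_on_int_powr: "(\<lambda>n::int. (1 + \<bar>real_of_int n\<bar>) powr (- 3 / 2)) summable_on UNIV"
proof -
  let ?f = "\<lambda>n::int. (1 + \<bar>real_of_int n\<bar>) powr (- 3 / 2)"
  have "summable (\<lambda>n. real (Suc n) powr (- 3 / 2))"
    by (subst summable_Suc_iff) (simp add: summable_real_powr_iff)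
  then have nat: "(\<lambda>n. (1 + real n) powr (- 3 / 2)) summable_on UNIV"
    by (subst summable_on_UNIV_nonneg_real_iff) (auto simp: add.commute)
  have "?f summable_on range int"
    by (subst summable_on_reindex) (use nat in \<open>auto simp: o_def\<close>)
  moreover have "?f summable_on range (\<lambda>n. - int n)"
    by (subst summable_on_reindex) (use nat in \<open>auto simp: o_def inj_on_def\<close>)
  ultimately have "?f summable_on (range int \<union> range (\<lambda>n. - int n))"
    by (rule summable_on_union)
  also have "range int \<union> range (\<lambda>n. - int n) = UNIV"
    by (auto simp: image_iff) (metis int_cases2)
  finally show ?thesis .
qed

text \<open>Because (1 + |a|)(1 + |b|) is at most the square of the height, the summand is dominated
  by a product of two convergent one-dimensional series.\<close>

lemma summable_on_height: "(\<lambda>p. 1 / height p ^ 3) summable_on UNIV"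
proof -
  define f where "f = (\<lambda>n::int. (1 + \<bar>real_of_int n\<bar>) powr (- 3 / 2))"
  have f: "f summable_on UNIV" unfolding f_def by (rule summable_on_int_powr)
  have f_nonneg: "f n \<ge> 0" for n by (simp add: f_def)
  have "(\<lambda>p. f (fst p) * f (snd p)) summable_on (UNIV \<times> UNIV)"
  proof (rule summable_on_SigmaI)
    show "((\<lambda>y. f (fst (x, y)) * f (snd (x, y))) has_sum f x * infsum f UNIV) UNIV" for x
      using f by (auto intro: has_sum_cmult_right)
    show "(\<lambda>x. f x * infsum f UNIV) summable_on UNIV"
      using f by (rule summable_on_cmult_left)
  qed (auto simp: f_nonneg)
  then have "(\<lambda>p. f (fst p) * f (snd p)) summable_on UNIV" by simp
  then show ?thesis
  proof (rule summable_on_comparison_test)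
    fix p :: "int \<times> int"
    let ?a = "\<bar>real_of_int (fst p)\<bar>" and ?b = "\<bar>real_of_int (snd p)\<bar>"
    have "(1 + ?a) * (1 + ?b) \<le> height p ^ 2"
    proof -
      have "height p ^ 2 = (1 + ?a) * (1 + ?b) + (?a + ?b + ?a * ?b + ?a\<^sup>2 + ?b\<^sup>2)"
        by (simp add: height_def power2_eq_square algebra_simps)
      moreover have "?a * ?b \<ge> 0" by simp
      ultimately show ?thesis
        using zero_le_power2[of ?a] zero_le_power2[of ?b] abs_ge_zero[of "real_of_int (fst p)"]
          abs_ge_zero[of "real_of_int (snd p)"] by linarith
    qed
    then have "(height p ^ 2) powr (- 3 / 2) \<le> ((1 + ?a) * (1 + ?b)) powr (- 3 / 2)"
      by (intro powr_mono2') auto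
    also have "\<dots> = f (fst p) * f (snd p)" by (simp add: f_def powr_mult)
    also have "(height p ^ 2) powr (- 3 / 2) = 1 / height p ^ 3"
    proof -
      have "height p > 0" using height_ge_1[of p] by linarith
      then have "(height p ^ 2) powr (- 3 / 2) = (height p powr 2) powr (- 3 / 2)"
        by (simp add: powr_realpow)
      also have "\<dots> = height p powr (- 3)" by (simp add: powr_powr)
      also have "\<dots> = 1 / height p ^ 3"
        using \<open>height p > 0\<close> by (simp add: powr_minus powr_realpow inverse_eq_divide)
      finally show ?thesis .
    qed
    finally show "1 / height p ^ 3 \<le> f (fst p) * f (snd p)" .
    show "0 \<le> 1 / height p ^ 3" using height_ge_1[of p] by simp
  qed
qed

lemma summable_on_height_row: "(\<lambda>b. 1 / height (a, b) ^ 2) summable_on UNIV"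
proof (rule summable_on_comparison_test[OF summable_on_int_powr])
  fix b :: int
  have "1 / height (a, b) ^ 2 \<le> 1 / (1 + \<bar>real_of_int b\<bar>) ^ 2"
    by (intro divide_left_mono power_mono mult_pos_pos zero_less_power) (auto simp: height_def)
  also have "\<dots> = (1 + \<bar>real_of_int b\<bar>) powr (- 2)"
    by (simp add: powr_minus powr_realpow inverse_eq_divide)
  also have "\<dots> \<le> (1 + \<bar>real_of_int b\<bar>) powr (- 3 / 2)"
    by (intro powr_mono) auto
  finally show "1 / height (a, b) ^ 2 \<le> (1 + \<bar>real_of_int b\<bar>) powr (- 3 / 2)" .
qed auto

lemma inj_lat_pt:
  assumes "\<tau> \<in> upper_half_plane"
  shows "inj (lat_pt \<tau>)"
proof (rule injI)
  fix p p' assume eq: "lat_pt \<tau> p = lat_pt \<tau> p'"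
  have "Im \<tau> > 0" using assms by (simp add: upper_half_plane_def)
  with arg_cong[OF eq, of Im] have fst: "fst p = fst p'" by (simp add: lat_pt_def)
  with eq have "snd p = snd p'" by (simp add: lat_pt_def)
  with fst show "p = p'" by (rule prod_eqI)
qed

lemma range_lat_pt: "range (lat_pt \<tau>) = lattice \<tau> 1"
proof -
  have "lat_pt \<tau> (a, b) = of_int a * \<tau> + of_int b" for a b by (simp add: lat_pt_def)
  then show ?thesis by (force simp: lattice_iff image_iff)
qed

lemma lat_pt_in_lattice [simp]: "lat_pt \<tau> p \<in> lattice \<tau> 1"
  using range_lat_pt by blast

lemma lat_pt_image_nonzero:
  assumes "\<tau> \<in> upper_half_plane"
  shows "lat_pt \<tau> ` (- {(0, 0)}) = lattice \<tau> 1 - {0}"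
proof -
  have "lat_pt \<tau> (0, 0) = 0" by (simp add: lat_pt_def)
  moreover have "lat_pt \<tau> ` (UNIV - {(0, 0)}) = range (lat_pt \<tau>) - lat_pt \<tau> ` {(0, 0)}"
    by (rule image_set_diff[OF inj_lat_pt[OF assms]])
  ultimately show ?thesis by (simp add: range_lat_pt Compl_eq_Diff_UNIV)
qed

lemma height_le_lat_pt:
  assumes "\<tau> \<in> upper_half_plane"
  shows "height p \<le> 1 + lattice_const \<tau> * norm (lat_pt \<tau> p)"
  using lattice_coords_bound[OF assms, of "real_of_int (fst p)" "real_of_int (snd p)"]
  by (simp add: height_def lat_pt_def)

lemma height_le_lat_pt_nonzero:
  assumes "\<tau> \<in> upper_half_plane" "p \<noteq> (0, 0)"
  shows "height p \<le> 2 * lattice_const \<tau> * norm (lat_pt \<tau> p)"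
proof -
  have "lat_pt \<tau> p \<noteq> 0"
    using lat_pt_image_nonzero[OF assms(1)] assms(2) by blast
  then have "1 / lattice_const \<tau> \<le> norm (lat_pt \<tau> p)"
    by (intro lattice_separated[OF assms(1)]) auto
  then have "1 \<le> lattice_const \<tau> * norm (lat_pt \<tau> p)"
    using lattice_const_pos[OF assms(1)] by (simp add: field_simps)
  then show ?thesis using height_le_lat_pt[OF assms(1), of p] by simp
qed

text \<open>The height is at most a constant plus a multiple of the distance to z, and the constant
  is absorbed by \<open>1 \<le> norm (z - lat_pt \<tau> p) / r\<close>. The resulting factor depends
  on \<tau> only through \<open>lattice_const\<close>.\<close>

lemma height_le_dist:
  assumes tau: "\<tau> \<in> upper_half_plane" and R: "norm z \<le> R" and r: "r > 0" "r \<le> norm (z - lat_pt \<tau> p)"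
  shows "height p \<le> (1 / r + lattice_const \<tau> + lattice_const \<tau> * R / r) * norm (z - lat_pt \<tau> p)"
proof -
  let ?C = "lattice_const \<tau>" and ?w = "lat_pt \<tau> p"
  have C: "?C > 0" by (rule lattice_const_pos[OF tau])
  have "R \<ge> 0" using R norm_ge_zero order.trans by blast
  have "norm ?w \<le> norm (z - ?w) + R"
    using norm_triangle_ineq2[of ?w z] R by (simp add: norm_minus_commute)
  then have "?C * norm ?w \<le> ?C * (norm (z - ?w) + R)"
    using C by (intro mult_left_mono) auto
  then have "height p \<le> 1 + ?C * (norm (z - ?w) + R)"
    using height_le_lat_pt[OF tau, of p] by linarith
  also have "\<dots> = (1 + ?C * R) * 1 + ?C * norm (z - ?w)" by (simp add: algebra_simps)
  also have "\<dots> \<le> (1 + ?C * R) * (norm (z - ?w) / r) + ?C * norm (z - ?w)"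
    using r C \<open>R \<ge> 0\<close> by (intro add_right_mono mult_left_mono) (auto simp: field_simps)
  also have "\<dots> = (1 / r + ?C + ?C * R / r) * norm (z - ?w)"
    using r by (simp add: field_simps)
  finally show ?thesis .
qed

text \<open>The correction terms turn the summand into z^2 / (w^2 (z - w)). Two powers of the height
  come from w and one from z - w.\<close>

lemma zeta_term_bound:
  assumes tau: "\<tau> \<in> upper_half_plane" and R: "norm z \<le> R" and r: "r > 0" "r \<le> norm (z - lat_pt \<tau> p)"
    and p: "p \<noteq> (0, 0)"
  shows "norm (zeta_term z (lat_pt \<tau> p)) \<le>
    R\<^sup>2 * (2 * lattice_const \<tau>)\<^sup>2 * (1 / r + lattice_const \<tau> + lattice_const \<tau> * R / r) * (1 / height p ^ 3)"
proof -
  let ?C = "lattice_const \<tau>" and ?w = "lat_pt \<tau> p" and ?h = "height p"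
  define D where "D = 1 / r + ?C + ?C * R / r"
  have h: "?h > 0" using height_ge_1[of p] by linarith
  note h1 = height_le_lat_pt_nonzero[OF tau p] and h2 = height_le_dist[OF tau R r, folded D_def]
  have w: "?w \<noteq> 0" "z - ?w \<noteq> 0" using h h1 h2 by auto
  then have "zeta_term z ?w = z\<^sup>2 / (?w\<^sup>2 * (z - ?w))"
    by (simp add: zeta_term_def field_simps power2_eq_square)
  then have "norm (zeta_term z ?w) = norm z ^ 2 / (norm ?w ^ 2 * norm (z - ?w))"
    by (simp add: norm_divide norm_mult norm_power)
  also have "\<dots> \<le> R\<^sup>2 / (norm ?w ^ 2 * norm (z - ?w))"
    using R by (intro divide_right_mono power_mono) auto
  also have "\<dots> \<le> R\<^sup>2 * ((2 * ?C)\<^sup>2 * D * (1 / ?h ^ 3))"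
  proof -
    have "?h ^ 2 * ?h \<le> (2 * ?C * norm ?w) ^ 2 * (D * norm (z - ?w))"
      using h h1 h2 by (intro mult_mono power_mono) auto
    then have "?h ^ 3 \<le> (2 * ?C)\<^sup>2 * D * (norm ?w ^ 2 * norm (z - ?w))"
      by (simp add: power_mult_distrib eval_nat_numeral mult_ac)
    then have "1 / (norm ?w ^ 2 * norm (z - ?w)) \<le> (2 * ?C)\<^sup>2 * D * (1 / ?h ^ 3)"
      using h w by (simp add: divide_simps mult_ac)
    then have "R\<^sup>2 * (1 / (norm ?w ^ 2 * norm (z - ?w))) \<le> R\<^sup>2 * ((2 * ?C)\<^sup>2 * D * (1 / ?h ^ 3))"
      by (rule mult_left_mono) auto
    then show ?thesis by simp
  qed
  finally show ?thesis unfolding D_def by (simp only: mult.assoc)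
qed

text \<open>Zeta without its principal part at the origin, hence still holomorphic at 0.\<close>

definition zeta_reg :: "complex \<Rightarrow> complex \<Rightarrow> complex" where
  "zeta_reg \<tau> z = (\<Sum>\<^sub>\<infinity>p\<in>- {(0, 0)}. zeta_term z (lat_pt \<tau> p))"

lemma weierstrass_zeta_eq:
  assumes "\<tau> \<in> upper_half_plane"
  shows "weierstrass_zeta z (lattice \<tau> 1) = 1 / z + zeta_reg \<tau> z"
proof -
  have "inj_on (lat_pt \<tau>) (- {(0, 0)})" using inj_lat_pt[OF assms] by (rule inj_on_subset) simp
  then have "zeta_reg \<tau> z = (\<Sum>\<^sub>\<infinity>w\<in>lattice \<tau> 1 - {0}. zeta_term z w)"
    unfolding zeta_reg_def lat_pt_image_nonzero[OF assms, symmetric]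
    by (subst infsum_reindex) (auto simp: o_def)
  then show ?thesis by (simp add: weierstrass_zeta_def zeta_term_def)
qed

lemma lattice_dist_pos:
  assumes "\<tau> \<in> upper_half_plane" "z \<notin> lattice \<tau> 1"
  obtains r where "r > 0" "\<And>p. r \<le> norm (z - lat_pt \<tau> p)"
proof -
  have "open (- lattice \<tau> 1)" using closed_lattice[OF assms(1)] by (simp add: open_Compl)
  then obtain r where r: "r > 0" "ball z r \<subseteq> - lattice \<tau> 1"
    using assms(2) openE[of "- lattice \<tau> 1" z] by auto
  have "r \<le> norm (z - lat_pt \<tau> p)" for p
  proof (rule ccontr)
    assume "\<not> r \<le> norm (z - lat_pt \<tau> p)"
    then have "lat_pt \<tau> p \<in> ball z r" by (simp add: dist_norm)
    then show False using r(2) lat_pt_in_lattice by blast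
  qed
  then show ?thesis using that r(1) by blast
qed

lemma zeta_term_summable:
  assumes "\<tau> \<in> upper_half_plane" "z \<notin> lattice \<tau> 1"
  shows "(\<lambda>p. zeta_term z (lat_pt \<tau> p)) summable_on UNIV"
proof -
  obtain r where r: "r > 0" "\<And>p. r \<le> norm (z - lat_pt \<tau> p)" using lattice_dist_pos[OF assms] by blast
  have "(\<lambda>p. norm (zeta_term z (lat_pt \<tau> p))) summable_on - {(0, 0)}"
    by (rule Infinite_Sum.abs_summable_on_comparison_test'[OF _ zeta_term_bound[OF assms(1) order.refl r]])
       (intro summable_on_cmult_right summable_on_subset[OF summable_on_height], auto)
  then have "(\<lambda>p. zeta_term z (lat_pt \<tau> p)) summable_on - {(0, 0)}"
    by (rule abs_summable_summable)
  then have "(\<lambda>p. zeta_term z (lat_pt \<tau> p)) summable_on insert (0, 0) (- {(0, 0)})"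
    by (simp only: summable_on_insert_iff)
  moreover have "insert (0, 0) (- {(0::int, 0::int)}) = UNIV" by auto
  ultimately show ?thesis by simp
qed

text \<open>With the polar term absorbed at index (0, 0) the sum runs over the whole of Z^2, so that
  adding a period to z amounts to a shift of the index.\<close>

lemma weierstrass_zeta_infsum:
  assumes "\<tau> \<in> upper_half_plane" "z \<notin> lattice \<tau> 1"
  shows "weierstrass_zeta z (lattice \<tau> 1) = (\<Sum>\<^sub>\<infinity>p. zeta_term z (lat_pt \<tau> p))"
proof -
  have "(\<lambda>p. zeta_term z (lat_pt \<tau> p)) summable_on - {(0, 0)}"
    by (rule summable_on_subset[OF zeta_term_summable[OF assms]]) simp
  then have "(\<Sum>\<^sub>\<infinity>p\<in>insert (0, 0) (- {(0, 0)}). zeta_term z (lat_pt \<tau> p)) =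
      zeta_term z (lat_pt \<tau> (0, 0)) + zeta_reg \<tau> z"
    unfolding zeta_reg_def by (rule infsum_insert) simp
  moreover have "zeta_term z (lat_pt \<tau> (0, 0)) = 1 / z"
    by (simp add: zeta_term_def lat_pt_def)
  moreover have "insert (0, 0) (- {(0::int, 0::int)}) = UNIV" by auto
  ultimately show ?thesis by (simp add: weierstrass_zeta_eq[OF assms(1)])
qed

lemma open_Compl_lattice_nonzero:
  assumes "\<tau> \<in> upper_half_plane"
  shows "open (- (lattice \<tau> 1 - {0}))"
proof -
  have "- (lattice \<tau> 1 - {0}) = - lattice \<tau> 1 \<union> ball 0 (1 / lattice_const \<tau>)"
    using lattice_inter_ball[OF assms] lattice_const_pos[OF assms] by auto
  then show ?thesis using closed_lattice[OF assms] by (simp add: open_Compl open_Un)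
qed

lemma zeta_reg_holomorphic:
  assumes tau: "\<tau> \<in> upper_half_plane"
  shows "zeta_reg \<tau> holomorphic_on - (lattice \<tau> 1 - {0})"
proof -
  let ?O = "- (lattice \<tau> 1 - {0})"
  let ?f = "\<lambda>X z. \<Sum>p\<in>X. zeta_term z (lat_pt \<tau> p)"
  have "\<exists>s>0. zeta_reg \<tau> holomorphic_on ball z s" if z: "z \<in> ?O" for z
  proof -
    obtain r where r: "r > 0" "ball z r \<subseteq> ?O"
      using openE[OF open_Compl_lattice_nonzero[OF tau] z] .
    \<comment> \<open>Half the radius, so that the closed disc keeps distance \<open>s\<close> from
      all nonzero lattice points.\<close>
    define s where "s = r / 2"
    have s: "s > 0" using r by (simp add: s_def)
    have dist: "s \<le> norm (x - lat_pt \<tau> p)" if "x \<in> cball z s" "p \<in> - {(0, 0)}" for x p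
    proof (rule ccontr)
      assume "\<not> s \<le> norm (x - lat_pt \<tau> p)"
      then have "dist x (lat_pt \<tau> p) < s" by (simp add: dist_norm)
      then have "lat_pt \<tau> p \<in> ball z r"
        using that(1) dist_triangle[of z "lat_pt \<tau> p" x] by (simp add: s_def)
      moreover have "lat_pt \<tau> p \<in> lattice \<tau> 1 - {0}"
        using lat_pt_image_nonzero[OF tau] that(2) by blast
      ultimately show False using r(2) by blast
    qed
    have R: "norm x \<le> norm z + s" if "x \<in> cball z s" for x
      using that norm_triangle_ineq2[of x z] by (simp add: dist_norm norm_minus_commute)
    have ul: "uniform_limit (cball z s) ?f (zeta_reg \<tau>) (finite_subsets_at_top (- {(0, 0)}))"
      unfolding zeta_reg_def[abs_def]
    proof (rule Weierstrass_m_test_general)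
      fix p x assume px: "p \<in> - {(0::int, 0::int)}" "x \<in> cball z s"
      show "norm (zeta_term x (lat_pt \<tau> p)) \<le> (norm z + s)\<^sup>2 * (2 * lattice_const \<tau>)\<^sup>2 *
        (1 / s + lattice_const \<tau> + lattice_const \<tau> * (norm z + s) / s) * (1 / height p ^ 3)"
        by (rule zeta_term_bound[OF tau R[OF px(2)] s dist[OF px(2,1)]]) (use px in auto)
    qed (intro summable_on_cmult_right summable_on_subset[OF summable_on_height], simp)
    have hol: "?f X holomorphic_on cball z s" if "X \<subseteq> - {(0, 0)}" for X
    proof -
      have "x - lat_pt \<tau> p \<noteq> 0" if "p \<in> X" "x \<in> cball z s" for p x
        using dist[of x p] s that \<open>X \<subseteq> _\<close> by fastforce
      moreover have "lat_pt \<tau> p \<noteq> 0" if "p \<in> X" for p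
        using lat_pt_image_nonzero[OF tau] that \<open>X \<subseteq> _\<close> by blast
      ultimately show ?thesis
        unfolding zeta_term_def by (intro holomorphic_intros) auto
    qed
    have "eventually (\<lambda>X. continuous_on (cball z s) (?f X) \<and> ?f X holomorphic_on ball z s)
        (finite_subsets_at_top (- {(0, 0)}))"
    proof (rule eventually_finite_subsets_at_top_weakI)
      fix X assume "X \<subseteq> - {(0::int, 0::int)}"
      from hol[OF this] show "continuous_on (cball z s) (?f X) \<and> ?f X holomorphic_on ball z s"
        by (auto intro: holomorphic_on_imp_continuous_on holomorphic_on_subset[OF _ ball_subset_cball])
    qed
    from holomorphic_uniform_limit[OF this ul] show ?thesis using s by auto
  qed
  then show ?thesis
    by (meson analytic_imp_holomorphic analytic_on_def)
qed

section \<open>Quasi-periods by telescoping\<close>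

lemma has_sum_diff:
  fixes f g :: "'a \<Rightarrow> 'b :: topological_ab_group_add"
  assumes "(f has_sum a) A" "(g has_sum b) A"
  shows "((\<lambda>x. f x - g x) has_sum (a - b)) A"
  using has_sum_add[OF assms(1), of "\<lambda>x. - g x" "- b"] assms(2) by (simp add: has_sum_uminus)

text \<open>A shift of the index leaves each row sum unchanged, so every row of differences sums to
  0. Decay of order 2 gives summable rows but no summable double series, hence the sum is first
  iterated and only then split into two.\<close>

lemma infsum_telescope_eq_0:
  fixes u :: "int \<Rightarrow> int \<Rightarrow> complex"
  assumes bound: "\<And>a b. norm (u a b) \<le> c / height (a, b) ^ 2"
    and sum: "((\<lambda>(a, b). u a (b - 1) - u a b) has_sum S) UNIV"
  shows "S = 0"
proof -
  have row: "(\<Sum>\<^sub>\<infinity>b. u a (b - 1) - u a b) = 0" for a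
  proof -
    have "(\<lambda>b. norm (u a b)) summable_on UNIV"
      by (rule Infinite_Sum.abs_summable_on_comparison_test'[of "\<lambda>b. c * (1 / height (a, b) ^ 2)"])
         (intro summable_on_cmult_right summable_on_height_row, use bound in auto)
    then have u: "u a summable_on UNIV" by (rule abs_summable_summable)
    have bij: "bij_betw (\<lambda>b::int. b - 1) UNIV UNIV"
      by (rule bij_betwI[of _ _ _ "\<lambda>b. b + 1"]) auto
    have "(\<lambda>b. u a (b - 1)) summable_on UNIV"
      using u summable_on_reindex_bij_betw[OF bij, of "u a"] by simp
    then have "(\<Sum>\<^sub>\<infinity>b. u a (b - 1) - u a b) = (\<Sum>\<^sub>\<infinity>b. u a (b - 1)) - (\<Sum>\<^sub>\<infinity>b. u a b)"
      using u by (intro infsumI has_sum_diff has_sum_infsum)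
    also have "\<dots> = 0" using infsum_reindex_bij_betw[OF bij, of "u a"] by simp
    finally show ?thesis .
  qed
  have "(\<lambda>(a, b). u a (b - 1) - u a b) summable_on (UNIV \<times> UNIV)"
    using sum by (auto simp: has_sum_iff)
  from infsum_Sigma'_banach[OF this] have "(\<Sum>\<^sub>\<infinity>(a, b). u a (b - 1) - u a b) = 0"
    by (simp add: row)
  then show ?thesis using sum by (simp add: has_sum_iff)
qed

text \<open>The first difference in w removes the terms 1/\<omega> and turns z/\<omega>^2 into
  w/\<omega>^2; comparing two base points removes that too. Only simple fractions remain, and adding
  w to z is the same as subtracting it from the pole.\<close>

lemma zeta_second_difference_has_sum:
  assumes tau: "\<tau> \<in> upper_half_plane" and z: "z \<notin> lattice \<tau> 1" "z' \<notin> lattice \<tau> 1"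
    and w: "w \<in> lattice \<tau> 1"
  defines "W \<equiv> \<lambda>x. weierstrass_zeta x (lattice \<tau> 1)"
    and "u \<equiv> \<lambda>x. 1 / (z - x) - 1 / (z' - x)"
  shows "((\<lambda>p. u (lat_pt \<tau> p - w) - u (lat_pt \<tau> p)) has_sum
           ((W (z + w) - W z) - (W (z' + w) - W z'))) UNIV"
proof -
  have W: "((\<lambda>p. zeta_term x (lat_pt \<tau> p)) has_sum W x) UNIV" if "x \<notin> lattice \<tau> 1" for x
    unfolding W_def weierstrass_zeta_infsum[OF tau that]
    using zeta_term_summable[OF tau that] by simp
  have zw: "z + w \<notin> lattice \<tau> 1" "z' + w \<notin> lattice \<tau> 1"
    using z w by (simp_all add: lattice_add_iff)
  have "((\<lambda>p. (zeta_term (z + w) (lat_pt \<tau> p) - zeta_term z (lat_pt \<tau> p)) -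
              (zeta_term (z' + w) (lat_pt \<tau> p) - zeta_term z' (lat_pt \<tau> p))) has_sum
           ((W (z + w) - W z) - (W (z' + w) - W z'))) UNIV"
    using z zw by (intro has_sum_diff W)
  then show ?thesis
    by (rule has_sum_cong[THEN iffD1, rotated])
       (simp add: zeta_term_def u_def algebra_simps add_divide_distrib)
qed

text \<open>Comparing two base points gains one order of decay, just enough for the rows to be
  summable.\<close>

lemma simple_pole_difference_bound:
  assumes tau: "\<tau> \<in> upper_half_plane" and z: "z \<notin> lattice \<tau> 1" "z' \<notin> lattice \<tau> 1"
  obtains c where "\<And>p. norm (1 / (z - lat_pt \<tau> p) - 1 / (z' - lat_pt \<tau> p)) \<le> c / height p ^ 2"
proof -
  obtain D where D: "\<And>p. height p \<le> D * norm (z - lat_pt \<tau> p)"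
    using lattice_dist_pos[OF tau z(1)] height_le_dist[OF tau order.refl[of "norm z"]] by metis
  obtain D' where D': "\<And>p. height p \<le> D' * norm (z' - lat_pt \<tau> p)"
    using lattice_dist_pos[OF tau z(2)] height_le_dist[OF tau order.refl[of "norm z'"]] by metis
  have "norm (1 / (z - lat_pt \<tau> p) - 1 / (z' - lat_pt \<tau> p)) \<le> (norm (z' - z) * (D * D')) / height p ^ 2" for p
  proof -
    let ?x = "z - lat_pt \<tau> p" and ?y = "z' - lat_pt \<tau> p"
    have h: "height p > 0" using height_ge_1[of p] by linarith
    have nz: "?x \<noteq> 0" "?y \<noteq> 0" using D[of p] D'[of p] h by auto
    have "1 / ?x - 1 / ?y = (z' - z) / (?x * ?y)" using nz by (simp add: field_simps)
    then have "norm (1 / ?x - 1 / ?y) = norm (z' - z) * (1 / (norm ?x * norm ?y))"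
      by (simp add: norm_divide norm_mult)
    also have "\<dots> \<le> norm (z' - z) * ((D * D') / height p ^ 2)"
    proof (rule mult_left_mono)
      have "height p * height p \<le> (D * norm ?x) * (D' * norm ?y)"
        using D[of p] D'[of p] h by (intro mult_mono) auto
      then show "1 / (norm ?x * norm ?y) \<le> (D * D') / height p ^ 2"
        using h nz by (simp add: divide_simps power2_eq_square mult_ac)
    qed auto
    finally show ?thesis by simp
  qed
  then show ?thesis using that by blast
qed

lemma zeta_quasi_period_1:
  assumes tau: "\<tau> \<in> upper_half_plane" and z: "z \<notin> lattice \<tau> 1" "z' \<notin> lattice \<tau> 1"
  shows "weierstrass_zeta (z + 1) (lattice \<tau> 1) - weierstrass_zeta z (lattice \<tau> 1) =
         weierstrass_zeta (z' + 1) (lattice \<tau> 1) - weierstrass_zeta z' (lattice \<tau> 1)"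
proof -
  define u where "u = (\<lambda>a b. 1 / (z - lat_pt \<tau> (a, b)) - 1 / (z' - lat_pt \<tau> (a, b)))"
  obtain c where c: "\<And>a b. norm (u a b) \<le> c / height (a, b) ^ 2"
    using simple_pole_difference_bound[OF assms] unfolding u_def by metis
  have *: "lat_pt \<tau> (a, b) - 1 = lat_pt \<tau> (a, b - 1)" for a b by (simp add: lat_pt_def)
  have "((\<lambda>(a, b). u a (b - 1) - u a b) has_sum
          ((weierstrass_zeta (z + 1) (lattice \<tau> 1) - weierstrass_zeta z (lattice \<tau> 1)) -
           (weierstrass_zeta (z' + 1) (lattice \<tau> 1) - weierstrass_zeta z' (lattice \<tau> 1)))) UNIV"
    using zeta_second_difference_has_sum[OF assms one_in_lattice]
    by (rule has_sum_cong[THEN iffD1, rotated]) (auto simp: u_def *)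
  from infsum_telescope_eq_0[OF c this] show ?thesis by simp
qed

lemma zeta_quasi_period_tau:
  assumes tau: "\<tau> \<in> upper_half_plane" and z: "z \<notin> lattice \<tau> 1" "z' \<notin> lattice \<tau> 1"
  shows "weierstrass_zeta (z + \<tau>) (lattice \<tau> 1) - weierstrass_zeta z (lattice \<tau> 1) =
         weierstrass_zeta (z' + \<tau>) (lattice \<tau> 1) - weierstrass_zeta z' (lattice \<tau> 1)"
proof -
  define u where "u = (\<lambda>b a. 1 / (z - lat_pt \<tau> (a, b)) - 1 / (z' - lat_pt \<tau> (a, b)))"
  have h: "height (a, b) = height (b, a)" for a b by (simp add: height_def)
  obtain c where c: "\<And>b a. norm (u b a) \<le> c / height (b, a) ^ 2"
    using simple_pole_difference_bound[OF assms] unfolding u_def by (metis h)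
  have *: "lat_pt \<tau> (a, b) - \<tau> = lat_pt \<tau> (a - 1, b)" for a b by (simp add: lat_pt_def algebra_simps)
  let ?S = "(weierstrass_zeta (z + \<tau>) (lattice \<tau> 1) - weierstrass_zeta z (lattice \<tau> 1)) -
           (weierstrass_zeta (z' + \<tau>) (lattice \<tau> 1) - weierstrass_zeta z' (lattice \<tau> 1))"
  have 1: "((\<lambda>(a, b). u b (a - 1) - u b a) has_sum ?S) UNIV"
    using zeta_second_difference_has_sum[OF assms tau_in_lattice]
    by (rule has_sum_cong[THEN iffD1, rotated]) (auto simp: u_def *)
  \<comment> \<open>The telescoping runs in the second coordinate, whereas \<tau> shifts the first;
    the two are exchanged.\<close>
  have "((\<lambda>(b, a). u b (a - 1) - u b a) has_sum ?S) UNIV"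
    by (rule has_sum_reindex_bij_witness[of UNIV prod.swap prod.swap UNIV, THEN iffD1, OF _ _ _ _ _ _ 1]) auto
  from infsum_telescope_eq_0[OF c this] show ?thesis by simp
qed

text \<open>The description defining \<open>eta\<close> has a usable value only once exactly one map
  satisfies it. Existence comes from extending the two increments linearly over the reals,
  uniqueness from the basis \<tau>, 1.\<close>

lemma eta_eqI:
  assumes tau: "\<tau> \<in> upper_half_plane"
    and 1: "\<And>z. z \<notin> lattice \<tau> 1 \<Longrightarrow> weierstrass_zeta (z + 1) (lattice \<tau> 1) = weierstrass_zeta z (lattice \<tau> 1) + h1"
    and 2: "\<And>z. z \<notin> lattice \<tau> 1 \<Longrightarrow> weierstrass_zeta (z + \<tau>) (lattice \<tau> 1) = weierstrass_zeta z (lattice \<tau> 1) + h2"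
  shows "eta 1 (lattice \<tau> 1) = h1" "eta \<tau> (lattice \<tau> 1) = h2"
proof -
  let ?L = "lattice \<tau> 1"
  let ?W = "\<lambda>z. weierstrass_zeta z ?L"
  have y: "Im \<tau> > 0" using tau by (simp add: upper_half_plane_def)
  \<comment> \<open>The real coefficients are the coordinates of \<open>w\<close> with respect to
    \<tau> and 1.\<close>
  define f where "f = (\<lambda>w. of_real (Im w / Im \<tau>) * h2 + of_real (Re w - Im w / Im \<tau> * Re \<tau>) * h1)"
  let ?P = "\<lambda>f. linear f \<and> (\<forall>w\<in>?L. \<forall>z. z \<notin> ?L \<longrightarrow> ?W (z + w) = ?W z + f w)"
  have f_coords: "f (of_real x * \<tau> + of_real t) = of_real x * h2 + of_real t * h1" for x t
    using y by (simp add: f_def)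
  have lin: "linear f"
    by (rule linearI) (simp_all add: f_def scaleR_conv_of_real algebra_simps add_divide_distrib)
  have step: "?W (z + of_int n * w) = ?W z + of_int n * h"
    if w: "w \<in> ?L" "\<And>z. z \<notin> ?L \<Longrightarrow> ?W (z + w) = ?W z + h" and z: "z \<notin> ?L"
      and nw: "\<And>n::int. of_int n * w \<in> ?L"
    for n :: int and w h z
  proof (induction n rule: int_induct[where k = 0])
    case (step1 i)
    have "z + of_int i * w \<notin> ?L" using z lattice_add_iff[OF nw] by simp
    from w(2)[OF this] step1 show ?case by (simp add: algebra_simps)
  next
    case (step2 i)
    have "z + of_int (i - 1) * w \<notin> ?L" using z lattice_add_iff[OF nw] by blast
    from w(2)[OF this] step2 show ?case by (simp add: algebra_simps)
  qed auto
  have n1: "of_int n * 1 \<in> ?L" for n :: int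
    unfolding lattice_iff by (rule exI[of _ 0], rule exI[of _ n]) simp
  have n2: "of_int n * \<tau> \<in> ?L" for n :: int
    unfolding lattice_iff by (rule exI[of _ n], rule exI[of _ 0]) simp
  have "?P f"
  proof (intro conjI ballI allI impI lin)
    fix w z assume w: "w \<in> ?L" and z: "z \<notin> ?L"
    obtain a b :: int where ab: "w = of_int a * \<tau> + of_int b" using w by (auto simp: lattice_iff)
    have "z + of_int a * \<tau> \<notin> ?L" using z lattice_add_iff[OF n2] by blast
    from step[OF one_in_lattice 1 this n1, of b] step[OF tau_in_lattice 2 z n2, of a]
    show "?W (z + w) = ?W z + f w"
      using f_coords[of "of_int a" "of_int b"] by (simp add: ab add.assoc)
  qed
  moreover have "g = f" if g: "?P g" for g
  proof
    fix w
    \<comment> \<open>One point off the lattice is enough to force the values of \<open>g\<close> at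
      1 and \<tau>; without such a point the functional equation would be vacuous.\<close>
    obtain z0 where z0: "z0 \<notin> ?L"
    proof
      show "1 / 2 \<notin> ?L"
      proof
        assume "1 / 2 \<in> ?L"
        then obtain a b :: int where ab: "1 / 2 = of_int a * \<tau> + of_int b" by (auto simp: lattice_iff)
        from arg_cong[OF ab, of Im] y have "a = 0" by simp
        with ab have "of_int (2 * b) = (1 :: complex)" by (simp add: field_simps)
        then have "2 * b = 1" unfolding of_int_eq_1_iff .
        then show False by presburger
      qed
    qed
    have g1: "g 1 = h1" using g 1[OF z0] z0 one_in_lattice by (metis add_left_cancel)
    have g2: "g \<tau> = h2" using g 2[OF z0] z0 tau_in_lattice by (metis add_left_cancel)
    define x t where "x = Im w / Im \<tau>" and "t = Re w - x * Re \<tau>"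
    have w: "w = x *\<^sub>R \<tau> + t *\<^sub>R 1" using y by (simp add: complex_eq_iff x_def t_def)
    have "g w = x *\<^sub>R g \<tau> + t *\<^sub>R g 1"
      using g unfolding w by (simp add: linear_add linear_scale)
    also have "\<dots> = f w" by (simp add: g1 g2 f_def x_def t_def scaleR_conv_of_real)
    finally show "g w = f w" .
  qed
  ultimately have "(THE f. ?P f) = f" by (rule the_equality)
  then have eta: "eta w ?L = f w" for w by (simp add: eta_def)
  show "eta 1 ?L = h1" "eta \<tau> ?L = h2"
    using f_coords[of 0 1] f_coords[of 1 0] by (simp_all add: eta)
qed

text \<open>The two half points differ by the period 1, so zeta at them determines
  \<open>eta 1\<close>. An integer and a half-integer differ by at least 1/2, which bounds the
  second coordinate of the difference from below.\<close>

lemma half_lattice_distance: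
  assumes "\<tau> \<in> upper_half_plane"
  shows "1 / (2 * lattice_const \<tau>) \<le> norm (1 / 2 - lat_pt \<tau> p)"
    and "1 / (2 * lattice_const \<tau>) \<le> norm (- 1 / 2 - lat_pt \<tau> p)"
    and "1 / 2 \<notin> lattice \<tau> 1" and "- 1 / 2 \<notin> lattice \<tau> 1"
proof -
  have *: "1 / (2 * lattice_const \<tau>) \<le> norm (s - lat_pt \<tau> p)" if s: "s = 1 / 2 \<or> s = - 1 / 2" for s p
  proof -
    obtain r :: real where r: "s = of_real r" "r = 1 / 2 \<or> r = - 1 / 2"
      using s by (metis of_real_1 of_real_divide of_real_minus of_real_numeral)
    have "1 / 2 \<le> \<bar>real_of_int (snd p) - r\<bar>"
    proof -
      have "snd p \<le> -1 \<or> snd p = 0 \<or> snd p \<ge> 1" by linarith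
      then have "real_of_int (snd p) \<le> -1 \<or> real_of_int (snd p) = 0 \<or> real_of_int (snd p) \<ge> 1"
        by linarith
      then show ?thesis using r(2) by (auto simp: abs_if)
    qed
    also have "\<dots> \<le> lattice_const \<tau> * norm (of_real (real_of_int (fst p)) * \<tau> + of_real (real_of_int (snd p) - r))"
      using lattice_coords_bound[OF assms, of "real_of_int (fst p)" "real_of_int (snd p) - r"] by linarith
    also have "of_real (real_of_int (fst p)) * \<tau> + of_real (real_of_int (snd p) - r) = - (s - lat_pt \<tau> p)"
      by (simp add: lat_pt_def r)
    finally show ?thesis
      using lattice_const_pos[OF assms] unfolding norm_minus_cancel by (simp add: field_simps)
  qed
  show "1 / (2 * lattice_const \<tau>) \<le> norm (1 / 2 - lat_pt \<tau> p)"
       "1 / (2 * lattice_const \<tau>) \<le> norm (- 1 / 2 - lat_pt \<tau> p)" by (auto intro!: *)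
  have "0 < 1 / (2 * lattice_const \<tau>)" using lattice_const_pos[OF assms] by simp
  then have "s \<noteq> lat_pt \<tau> p" if s: "s = 1 / 2 \<or> s = - 1 / 2" for s p
    using *[OF s, of p] by force
  then show "1 / 2 \<notin> lattice \<tau> 1" "- 1 / 2 \<notin> lattice \<tau> 1"
    unfolding range_lat_pt[symmetric] by blast+
qed

lemma zeta_quasi_periodic:
  assumes "\<tau> \<in> upper_half_plane" "z \<notin> lattice \<tau> 1"
  shows "weierstrass_zeta (z + 1) (lattice \<tau> 1) = weierstrass_zeta z (lattice \<tau> 1) + eta 1 (lattice \<tau> 1)"
    and "weierstrass_zeta (z + \<tau>) (lattice \<tau> 1) = weierstrass_zeta z (lattice \<tau> 1) + eta \<tau> (lattice \<tau> 1)"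
proof -
  let ?W = "\<lambda>z. weierstrass_zeta z (lattice \<tau> 1)"
  let ?h1 = "?W (1 / 2 + 1) - ?W (1 / 2)" and ?h2 = "?W (1 / 2 + \<tau>) - ?W (1 / 2)"
  have 1: "?W (z + 1) = ?W z + ?h1" if "z \<notin> lattice \<tau> 1" for z
    using zeta_quasi_period_1[OF assms(1) that half_lattice_distance(3)[OF assms(1)]] by (simp add: algebra_simps)
  have 2: "?W (z + \<tau>) = ?W z + ?h2" if "z \<notin> lattice \<tau> 1" for z
    using zeta_quasi_period_tau[OF assms(1) that half_lattice_distance(3)[OF assms(1)]] by (simp add: algebra_simps)
  show "?W (z + 1) = ?W z + eta 1 (lattice \<tau> 1)"
    using 1[OF assms(2)] eta_eqI(1)[OF assms(1) 1 2] by simp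
  show "?W (z + \<tau>) = ?W z + eta \<tau> (lattice \<tau> 1)"
    using 2[OF assms(2)] eta_eqI(2)[OF assms(1) 1 2] by simp
qed

section \<open>The Legendre relation\<close>

lemma deriv_shift: "deriv (\<lambda>x. f (x + c)) z = deriv f (z + c)"
  by (simp add: deriv_def DERIV_shift)

text \<open>The multiplier \<open>- e (- z)\<close> has constant logarithmic derivative; this is the
  source of the constant in the Legendre relation.\<close>

lemma theta_logderiv_add_tau:
  assumes tau: "\<tau> \<in> upper_half_plane" and z: "z \<notin> lattice \<tau> 1"
  shows "deriv (theta \<tau>) (z + \<tau>) / theta \<tau> (z + \<tau>) = deriv (theta \<tau>) z / theta \<tau> z - 2 * of_real pi * \<i>"
proof -
  have th: "(theta \<tau> has_field_derivative deriv (theta \<tau>) z) (at z)"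
    using theta_holomorphic[OF tau, of UNIV] holomorphic_derivI by blast
  have "((\<lambda>x. - e (- x)) has_field_derivative 2 * of_real pi * \<i> * e (- z)) (at z)"
    unfolding e_def by (auto intro!: derivative_eq_intros)
  from DERIV_mult[OF this th] have
    "((\<lambda>x. - e (- x) * theta \<tau> x) has_field_derivative
       2 * of_real pi * \<i> * e (- z) * theta \<tau> z + deriv (theta \<tau>) z * - e (- z)) (at z)" .
  then have "deriv (\<lambda>x. theta \<tau> (x + \<tau>)) z = 2 * of_real pi * \<i> * e (- z) * theta \<tau> z + deriv (theta \<tau>) z * - e (- z)"
    unfolding theta_add_tau[OF tau] by (rule DERIV_imp_deriv)
  then have "deriv (theta \<tau>) (z + \<tau>) = - e (- z) * (deriv (theta \<tau>) z - 2 * of_real pi * \<i> * theta \<tau> z)"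
    unfolding deriv_shift by (simp add: algebra_simps)
  then have "deriv (theta \<tau>) (z + \<tau>) / theta \<tau> (z + \<tau>) =
      (deriv (theta \<tau>) z - 2 * of_real pi * \<i> * theta \<tau> z) / theta \<tau> z"
    unfolding theta_add_tau[OF tau] by (simp del: mult_minus_left)
  then show ?thesis
    using theta_nonzero[OF tau z] by (simp add: diff_divide_distrib)
qed

text \<open>Zeta and the logarithmic derivative of theta have the same polar part at 0, and both
  change by constants under periods. The derivative of their difference is therefore elliptic
  without poles, hence constant. The difference is affine, and its slope ties the increment along
  \<tau> to the increment along 1.\<close>

theorem legendre_relation:
  assumes tau: "\<tau> \<in> upper_half_plane"
  shows "eta \<tau> (lattice \<tau> 1) = \<tau> * eta 1 (lattice \<tau> 1) - 2 * of_real pi * \<i>"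
proof -
  let ?L = "lattice \<tau> 1" and ?O = "- (lattice \<tau> 1 - {0})"
  let ?W = "\<lambda>z. weierstrass_zeta z ?L"
  obtain T where T: "T holomorphic_on UNIV" "T 0 \<noteq> 0" "\<And>z. theta \<tau> z = z * T z"
    using theta_simple_zero[OF tau] by blast
  \<comment> \<open>Zeta minus the logarithmic derivative of theta, with the two terms 1/z already
    cancelled, so that holomorphy at 0 is visible.\<close>
  define E where "E = (\<lambda>z. zeta_reg \<tau> z - deriv T z / T z)"
  have T_nz: "T z \<noteq> 0" if "z \<in> ?O" for z
    using that T(2) T(3)[of z] theta_nonzero[OF tau, of z] by (cases "z = 0") auto
  have opO: "open ?O" by (rule open_Compl_lattice_nonzero[OF tau])
  have opL: "open (- ?L)" using closed_lattice[OF tau] by (simp add: open_Compl)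
  have E_hol: "E holomorphic_on ?O"
    unfolding E_def
    by (intro holomorphic_on_diff holomorphic_on_divide zeta_reg_holomorphic[OF tau] T_nz
        holomorphic_on_subset[OF holomorphic_deriv[OF T(1)]] holomorphic_on_subset[OF T(1)]) auto
  have E_eq: "E z = ?W z - deriv (theta \<tau>) z / theta \<tau> z" if z: "z \<notin> ?L" for z
  proof -
    have z0: "z \<noteq> 0" using z zero_in_lattice by metis
    have Tz: "T z \<noteq> 0" using T_nz z by auto
    have "(T has_field_derivative deriv T z) (at z)" using holomorphic_derivI[OF T(1)] by auto
    then have "((\<lambda>z. z * T z) has_field_derivative (T z + z * deriv T z)) (at z)"
      by (auto intro!: derivative_eq_intros)
    then have "deriv (theta \<tau>) z = T z + z * deriv T z"
      using DERIV_imp_deriv T(3) by (simp add: fun_eq_iff[of "theta \<tau>" "\<lambda>z. z * T z", THEN iffD2])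
    then have "deriv (theta \<tau>) z / theta \<tau> z = 1 / z + deriv T z / T z"
      using z0 Tz by (simp add: T(3) field_simps)
    then show ?thesis by (simp add: E_def weierstrass_zeta_eq[OF tau])
  qed
  have shift1: "E (z + 1) = E z + eta 1 ?L" if z: "z \<notin> ?L" for z
  proof -
    have "deriv (theta \<tau>) (z + 1) = deriv (theta \<tau>) z"
      using deriv_shift[of "theta \<tau>" 1 z] by (simp add: theta_add_1)
    moreover have "z + 1 \<notin> ?L" using z by (simp add: lattice_add_iff)
    ultimately show ?thesis
      using z by (simp add: E_eq zeta_quasi_periodic[OF tau] theta_add_1)
  qed
  have shiftt: "E (z + \<tau>) = E z + (eta \<tau> ?L + 2 * of_real pi * \<i>)" if z: "z \<notin> ?L" for z
  proof -
    have "z + \<tau> \<notin> ?L" using z by (simp add: lattice_add_iff)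
    then show ?thesis
      using z by (simp add: E_eq zeta_quasi_periodic[OF tau] theta_logderiv_add_tau[OF tau])
  qed
  have deriv_shift_eq: "deriv E (z + w) = deriv E z"
    if z: "z \<notin> ?L" and sh: "\<And>z. z \<notin> ?L \<Longrightarrow> E (z + w) = E z + c" for z w c
  proof -
    have "deriv E (z + w) = deriv (\<lambda>x. E (x + w)) z" by (simp add: deriv_shift)
    also have "\<dots> = deriv (\<lambda>x. E x + c) z"
      by (rule deriv_cong_ev) (use sh opL z in \<open>auto intro: eventually_nhds_in_open[THEN eventually_mono]\<close>)
    also have "\<dots> = deriv E z"
      using holomorphic_derivI[OF E_hol opO, of z] z
      by (intro DERIV_imp_deriv) (auto intro!: derivative_eq_intros)
    finally show ?thesis .
  qed
  have dE_hol: "deriv E holomorphic_on ?O" using holomorphic_deriv[OF E_hol opO] .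
  have "isCont (deriv E) 0"
    using holomorphic_on_imp_continuous_on[OF dE_hol] opO by (auto simp: continuous_on_eq_continuous_at)
  then have lim: "(deriv E \<longlongrightarrow> deriv E 0) (at 0)" by (simp add: isCont_def)
  define \<alpha> where "\<alpha> = deriv E 0"
  have dE: "deriv E z = \<alpha>" if "z \<notin> ?L" for z
    unfolding \<alpha>_def
    by (rule elliptic_const[OF tau _ _ _ lim that])
       (use deriv_shift_eq shift1 shiftt dE_hol in \<open>auto intro: holomorphic_on_subset\<close>)
  \<comment> \<open>Derivative 0 implies constancy only on a connected set; the plane stays
    connected when countably many points are removed.\<close>
  have "countable ?L"
    unfolding range_lat_pt[symmetric] by simp
  then have conn: "connected (- ?L)"
    by (intro path_connected_imp_connected path_connected_complement_countable) auto
  have "((\<lambda>z. E z - \<alpha> * z) has_field_derivative 0) (at z)" if "z \<in> - ?L" for z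
  proof -
    have "(E has_field_derivative deriv E z) (at z)"
      using holomorphic_derivI[OF E_hol opO] that by auto
    then show ?thesis using dE[of z] that by (auto intro!: derivative_eq_intros)
  qed
  note D0 = this
  have "continuous_on (- ?L) (\<lambda>z. E z - \<alpha> * z)"
    by (intro continuous_at_imp_continuous_on ballI DERIV_isCont[OF D0])
  from DERIV_zero_connected_constant[OF conn opL finite.emptyI this] D0
  obtain c where c: "\<And>z. z \<notin> ?L \<Longrightarrow> E z - \<alpha> * z = c" by auto
  \<comment> \<open>Evaluating the affine function at one point and at its two translates reads off
    both increments.\<close>
  let ?z = "1 / 2 :: complex"
  have nz: "?z \<notin> ?L" "?z + 1 \<notin> ?L" "?z + \<tau> \<notin> ?L"
    using half_lattice_distance(3)[OF tau] by (simp_all only: lattice_add_iff one_in_lattice tau_in_lattice not_False_eq_True)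
  have 1: "eta 1 ?L = \<alpha>"
    using c[OF nz(1)] c[OF nz(2)] shift1[OF nz(1)] by (simp add: algebra_simps)
  have "eta \<tau> ?L + 2 * of_real pi * \<i> = \<alpha> * \<tau>"
    using c[OF nz(1)] c[OF nz(3)] shiftt[OF nz(1)] by (simp add: algebra_simps)
  then show ?thesis using 1 by (simp add: algebra_simps eq_diff_eq)
qed

text \<open>The quasi-period is the difference of zeta at 1/2 and -1/2, where the distance to the
  lattice is explicit. The series on the right does not involve \<tau>, so a common \<open>C\<close>
  gives a common bound.\<close>

lemma norm_eta_1_le:
  assumes tau: "\<tau> \<in> upper_half_plane" and C: "lattice_const \<tau> \<le> C"
  shows "norm (eta 1 (lattice \<tau> 1)) \<le> 4 + 2 * (C\<^sup>2 * (3 * C + C\<^sup>2) * (\<Sum>\<^sub>\<infinity>p\<in>- {(0, 0)}. 1 / height p ^ 3))"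
proof -
  let ?c = "lattice_const \<tau>"
  let ?S = "\<Sum>\<^sub>\<infinity>p\<in>- {(0, 0)}. 1 / height p ^ 3"
  have c: "?c > 0" by (rule lattice_const_pos[OF tau])
  have hs: "((\<lambda>p. 1 / height p ^ 3) has_sum ?S) (- {(0, 0)})"
    by (rule has_sum_infsum) (rule summable_on_subset[OF summable_on_height], simp)
  have S: "?S \<ge> 0"
    by (rule infsum_nonneg) (use height_ge_1 in \<open>auto intro!: divide_nonneg_nonneg zero_le_power simp: height_def\<close>)
  have reg: "norm (zeta_reg \<tau> s) \<le> C\<^sup>2 * (3 * C + C\<^sup>2) * ?S"
    if s: "norm s = 1 / 2" "s \<notin> lattice \<tau> 1" "\<And>p. 1 / (2 * ?c) \<le> norm (s - lat_pt \<tau> p)" for s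
  proof -
    have r: "1 / (2 * ?c) > 0" using c by simp
    have "((\<lambda>p. zeta_term s (lat_pt \<tau> p)) has_sum zeta_reg \<tau> s) (- {(0, 0)})"
      unfolding zeta_reg_def
      by (rule has_sum_infsum) (rule summable_on_subset[OF zeta_term_summable[OF tau s(2)]], simp)
    then have "norm (zeta_reg \<tau> s) \<le> ?c\<^sup>2 * (3 * ?c + ?c\<^sup>2) * ?S"
    proof (rule norm_infsum_le[OF _ has_sum_cmult_right[OF hs]])
      fix p assume "p \<in> - {(0::int, 0::int)}"
      then have "norm (zeta_term s (lat_pt \<tau> p)) \<le> (1 / 2)\<^sup>2 * (2 * ?c)\<^sup>2 *
          (1 / (1 / (2 * ?c)) + ?c + ?c * (1 / 2) / (1 / (2 * ?c))) * (1 / height p ^ 3)"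
        by (intro zeta_term_bound[OF tau _ r s(3)]) (use s in auto)
      also have "(1 / 2)\<^sup>2 * (2 * ?c)\<^sup>2 * (1 / (1 / (2 * ?c)) + ?c + ?c * (1 / 2) / (1 / (2 * ?c)))
          = ?c\<^sup>2 * (3 * ?c + ?c\<^sup>2)"
        by (simp add: power2_eq_square field_simps)
      finally show "norm (zeta_term s (lat_pt \<tau> p)) \<le> ?c\<^sup>2 * (3 * ?c + ?c\<^sup>2) * (1 / height p ^ 3)" .
    qed
    also have "\<dots> \<le> C\<^sup>2 * (3 * C + C\<^sup>2) * ?S"
      using c C S by (intro mult_right_mono mult_mono add_mono power_mono) auto
    finally show ?thesis .
  qed
  have "eta 1 (lattice \<tau> 1) = (1 / (1 / 2) + zeta_reg \<tau> (1 / 2)) - (1 / (- 1 / 2) + zeta_reg \<tau> (- 1 / 2))"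
    using zeta_quasi_periodic(1)[OF tau half_lattice_distance(4)[OF tau]] 
    by (simp add: weierstrass_zeta_eq[OF tau] algebra_simps)
  \<comment> \<open>The polar terms at 1/2 and -1/2 are 2 and -2.\<close>
  also have "\<dots> = 4 + (zeta_reg \<tau> (1 / 2) - zeta_reg \<tau> (- 1 / 2))" by simp
  also have "norm \<dots> \<le> norm (4 :: complex) + norm (zeta_reg \<tau> (1 / 2) - zeta_reg \<tau> (- 1 / 2))"
    by (rule norm_triangle_ineq)
  also have "\<dots> \<le> norm (4 :: complex) + (norm (zeta_reg \<tau> (1 / 2)) + norm (zeta_reg \<tau> (- 1 / 2)))"
    by (intro add_left_mono norm_triangle_ineq4)
  also have "\<dots> \<le> 4 + (C\<^sup>2 * (3 * C + C\<^sup>2) * ?S + C\<^sup>2 * (3 * C + C\<^sup>2) * ?S)"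
    using half_lattice_distance[OF tau] by (intro add_mono reg) auto
  finally show ?thesis by simp
qed

section \<open>Modular forms of nonpositive weight\<close>

text \<open>Only finitely many lattice vectors have norm at most 1, and the vector 1 is among them,
  so minimising over these is enough.\<close>

lemma exists_shortest_lattice_vector:
  assumes tau: "\<tau> \<in> upper_half_plane"
  obtains c d :: int where "(c, d) \<noteq> (0, 0)"
    "\<And>c' d' :: int. (c', d') \<noteq> (0, 0) \<Longrightarrow> norm (of_int c * \<tau> + of_int d) \<le> norm (of_int c' * \<tau> + of_int d')"
proof -
  define S where "S = {p. p \<noteq> (0, 0) \<and> norm (lat_pt \<tau> p) \<le> 1}"
  have "S \<subseteq> {-\<lceil>lattice_const \<tau>\<rceil>..\<lceil>lattice_const \<tau>\<rceil>} \<times> {-\<lceil>lattice_const \<tau>\<rceil>..\<lceil>lattice_const \<tau>\<rceil>}"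
  proof
    fix p assume "p \<in> S"
    then have "norm (lat_pt \<tau> p) \<le> 1" by (simp add: S_def)
    then have "lattice_const \<tau> * norm (lat_pt \<tau> p) \<le> lattice_const \<tau>"
      using lattice_const_pos[OF tau] by (simp add: mult_left_le)
    then have "\<bar>real_of_int (fst p)\<bar> + \<bar>real_of_int (snd p)\<bar> \<le> lattice_const \<tau>"
      using height_le_lat_pt[OF tau, of p] by (simp add: height_def)
    then have "real_of_int (\<bar>fst p\<bar> + \<bar>snd p\<bar>) \<le> of_int \<lceil>lattice_const \<tau>\<rceil>"
      by (simp add: order.trans[OF _ le_of_int_ceiling])
    then have "\<bar>fst p\<bar> + \<bar>snd p\<bar> \<le> \<lceil>lattice_const \<tau>\<rceil>" unfolding of_int_le_iff .
    then show "p \<in> {-\<lceil>lattice_const \<tau>\<rceil>..\<lceil>lattice_const \<tau>\<rceil>} \<times> {-\<lceil>lattice_const \<tau>\<rceil>..\<lceil>lattice_const \<tau>\<rceil>}"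
      by (cases p) auto
  qed
  then have fin: "finite S" by (rule finite_subset) simp
  have "(0, 1) \<in> S" by (simp add: S_def lat_pt_def)
  then have ne: "S \<noteq> {}" by blast
  define p where "p = arg_min_on (\<lambda>p. norm (lat_pt \<tau> p)) S"
  have p: "p \<in> S" "\<And>p'. p' \<in> S \<Longrightarrow> norm (lat_pt \<tau> p) \<le> norm (lat_pt \<tau> p')"
    using arg_min_if_finite[OF fin ne, of "\<lambda>p. norm (lat_pt \<tau> p)"] by (auto simp: p_def not_less)
  have "norm (lat_pt \<tau> p) \<le> norm (lat_pt \<tau> p')" if "p' \<noteq> (0, 0)" for p'
    using p p(2)[of p'] that by (cases "p' \<in> S") (auto simp: S_def)
  then show ?thesis
    using that[of "fst p" "snd p"] p(1) by (force simp: S_def lat_pt_def)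
qed

lemma Im_moebius:
  fixes a b c d :: int
  assumes "a * d - b * c = 1" "\<tau> \<in> upper_half_plane"
  shows "Im ((of_int a * \<tau> + of_int b) / (of_int c * \<tau> + of_int d)) = Im \<tau> / norm (of_int c * \<tau> + of_int d) ^ 2"
    and "of_int c * \<tau> + of_int d \<noteq> 0"
    and "(of_int a * \<tau> + of_int b) / (of_int c * \<tau> + of_int d) \<in> upper_half_plane"
proof -
  have y: "Im \<tau> > 0" using assms(2) by (simp add: upper_half_plane_def)
  show nz: "of_int c * \<tau> + of_int d \<noteq> 0"
  proof
    assume 0: "of_int c * \<tau> + of_int d = 0"
    from arg_cong[OF 0, of Im] y have "c = 0" by simp
    with 0 assms(1) show False by simp
  qed
  have det: "real_of_int a * real_of_int d - real_of_int b * real_of_int c = 1"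
    using arg_cong[OF assms(1), of real_of_int] by simp
  have "Im ((of_int a * \<tau> + of_int b) * cnj (of_int c * \<tau> + of_int d)) =
      (real_of_int a * real_of_int d - real_of_int b * real_of_int c) * Im \<tau>"
    by (simp add: algebra_simps)
  then show *: "Im ((of_int a * \<tau> + of_int b) / (of_int c * \<tau> + of_int d)) = Im \<tau> / norm (of_int c * \<tau> + of_int d) ^ 2"
    unfolding det Im_complex_div_eq_0 by (subst complex_div_cnj) (simp add: det)
  show "(of_int a * \<tau> + of_int b) / (of_int c * \<tau> + of_int d) \<in> upper_half_plane"
    using * nz y by (simp add: upper_half_plane_def)
qed

text \<open>Take a shortest vector as denominator. Its coordinates are coprime, as division by their
  gcd would shorten it. Any numerator is at least as long, so the image has modulus at least 1, and
  a translation brings its real part into [-1/2, 1/2].\<close>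

lemma exists_moebius_Im_ge_half:
  assumes tau: "\<tau> \<in> upper_half_plane"
  obtains a b c d :: int where "a * d - b * c = 1"
    "Im ((of_int a * \<tau> + of_int b) / (of_int c * \<tau> + of_int d)) \<ge> 1 / 2"
proof -
  obtain c d :: int where cd: "(c, d) \<noteq> (0, 0)"
    and min: "\<And>c' d' :: int. (c', d') \<noteq> (0, 0) \<Longrightarrow> norm (of_int c * \<tau> + of_int d) \<le> norm (of_int c' * \<tau> + of_int d')"
    using exists_shortest_lattice_vector[OF tau] by blast
  let ?w = "of_int c * \<tau> + of_int d"
  have "gcd c d = 1"
  proof -
    let ?g = "gcd c d"
    have g: "?g > 0" using cd by auto
    obtain c' d' where c': "c = ?g * c'" "d = ?g * d'" by (meson dvdE gcd_dvd1 gcd_dvd2)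
    have "?w = of_int ?g * (of_int c' * \<tau> + of_int d')"
      by (subst c'(1), subst c'(2)) (simp add: algebra_simps)
    then have w: "norm ?w = of_int ?g * norm (of_int c' * \<tau> + of_int d')"
      using g by (simp add: norm_mult)
    have ne: "(c', d') \<noteq> (0, 0)" using cd c' by (metis mult_zero_right prod.inject)
    have "norm (of_int c' * \<tau> + of_int d') > 0"
    proof -
      have "lat_pt \<tau> (c', d') \<in> lattice \<tau> 1 - {0}" using lat_pt_image_nonzero[OF tau] ne by blast
      then show ?thesis by (simp add: lat_pt_def)
    qed
    moreover have "of_int ?g * norm (of_int c' * \<tau> + of_int d') \<le> 1 * norm (of_int c' * \<tau> + of_int d')"
      using min[OF ne] w by simp
    ultimately have "real_of_int ?g \<le> 1" by (simp only: mult_le_cancel_right_pos)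
    then show ?thesis using g by linarith
  qed
  \<comment> \<open>Bezout completes (c, d) to a matrix with first row (v, -u); subtracting
    \<open>n\<close> times the second row from the first translates \<open>t\<close> by
    \<open>- n\<close>.\<close>
  then obtain u v where uv: "u * c + v * d = 1" using bezout_int[of c d] by metis
  define t where "t = (of_int v * \<tau> + of_int (- u)) / ?w"
  define n where "n = round (Re t)"
  define a where "a = v - n * c"
  define b where "b = - u - n * d"
  have det: "a * d - b * c = 1" using uv by (simp add: a_def b_def algebra_simps)
  let ?t = "(of_int a * \<tau> + of_int b) / ?w"
  note M = Im_moebius[OF det tau]
  have t: "?t = t - of_int n"
    using M(2) by (simp add: t_def a_def b_def field_simps)
  have "(a, b) \<noteq> (0, 0)" using det by auto
  from min[OF this] have "1 \<le> norm ?t"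
    using M(2) by (simp add: norm_divide field_simps)
  then have "1\<^sup>2 \<le> norm ?t ^ 2" by (intro power_mono) auto
  then have "1 \<le> (Re ?t)\<^sup>2 + (Im ?t)\<^sup>2" by (simp add: cmod_power2)
  moreover have "(Re ?t)\<^sup>2 \<le> (1 / 2)\<^sup>2"
    unfolding abs_le_square_iff[symmetric] t
    using of_int_round_abs_le[of "Re t"] by (simp add: n_def abs_minus_commute)
  \<comment> \<open>The difference is in fact at least 3/4; passing to 1/4 keeps the constant
    rational.\<close>
  ultimately have "(1 / 2)\<^sup>2 \<le> (Im ?t)\<^sup>2" by (simp add: power2_eq_square)
  then have "1 / 2 \<le> Im ?t"
    using M(3) by (intro power2_le_imp_le[of "1 / 2"]) (auto simp: upper_half_plane_def)
  with det show ?thesis using that by blast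
qed

section \<open>Growth of modular functions of weight -n\<close>

lemma exists_e_preimage:
  assumes "w \<noteq> 0" "norm w < 1"
  obtains \<tau> where "\<tau> \<in> upper_half_plane" "e \<tau> = w"
proof
  let ?t = "Ln w / (2 * of_real pi * \<i>)"
  show eq: "e ?t = w" using assms(1) by (simp add: e_def)
  have "exp (- 2 * pi * Im ?t) < 1" using norm_e[of ?t] eq assms(2) by simp
  then have "2 * pi * Im ?t > 0" by simp
  then show "?t \<in> upper_half_plane" unfolding upper_half_plane_def by (simp add: zero_less_mult_iff)
qed

text \<open>Moving \<tau> up to imaginary part at least 1/2 costs the factor |c\<tau> + d|^n, and
  that lower bound on the new imaginary part says precisely |c\<tau> + d|^2 \<le> 2 Im \<tau>.
  Squaring avoids the exponent n/2.\<close>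

lemma modular_weight_nonpos_bound:
  fixes f :: "complex \<Rightarrow> complex"
  assumes modular: "\<And>a b c d :: int. \<And>\<tau>. a * d - b * c = 1 \<Longrightarrow> \<tau> \<in> upper_half_plane \<Longrightarrow>
      f ((of_int a * \<tau> + of_int b) / (of_int c * \<tau> + of_int d)) * (of_int c * \<tau> + of_int d) ^ n = f \<tau>"
    and B: "\<And>\<tau>. Im \<tau> \<ge> 1 / 2 \<Longrightarrow> norm (f \<tau>) \<le> B"
    and tau: "\<tau> \<in> upper_half_plane"
  shows "norm (f \<tau>) ^ 2 \<le> B\<^sup>2 * (2 * Im \<tau>) ^ n"
proof -
  obtain a b c d :: int where det: "a * d - b * c = 1"
    and half: "Im ((of_int a * \<tau> + of_int b) / (of_int c * \<tau> + of_int d)) \<ge> 1 / 2"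
    using exists_moebius_Im_ge_half[OF tau] by blast
  let ?w = "of_int c * \<tau> + of_int d"
  note M = Im_moebius[OF det tau]
  have w: "norm ?w ^ 2 \<le> 2 * Im \<tau>"
    using half M(2) unfolding M(1) by (simp add: field_simps)
  have "norm (f \<tau>) = norm (f ((of_int a * \<tau> + of_int b) / ?w)) * norm ?w ^ n"
    using modular[OF det tau] by (metis norm_mult norm_power)
  also have "\<dots> \<le> B * norm ?w ^ n"
    using B[OF half] by (intro mult_right_mono) auto
  finally have "norm (f \<tau>) ^ 2 \<le> (B * norm ?w ^ n) ^ 2" by (intro power_mono) auto
  also have "\<dots> = B\<^sup>2 * (norm ?w ^ 2) ^ n"
    by (simp add: power_mult_distrib power_mult[symmetric] mult.commute)
  also have "\<dots> \<le> B\<^sup>2 * (2 * Im \<tau>) ^ n"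
    using w by (intro mult_left_mono power_mono) auto
  finally show ?thesis .
qed

text \<open>The bound above forces \<open>g\<close> to vanish at the boundary of the unit disc if \<open>n > 0\<close>. For \<open>n = 0\<close> it means
  that \<open>\<bar>g\<bar>\<close> attains its maximum inside the disc.\<close>

context
  fixes f g :: "complex \<Rightarrow> complex" and n :: nat
  assumes modular: "\<And>a b c d :: int. \<And>\<tau>. a * d - b * c = 1 \<Longrightarrow> \<tau> \<in> upper_half_plane \<Longrightarrow>
      f ((of_int a * \<tau> + of_int b) / (of_int c * \<tau> + of_int d)) * (of_int c * \<tau> + of_int d) ^ n = f \<tau>"
    and g: "g holomorphic_on ball 0 1"
    and fg: "\<And>\<tau>. \<tau> \<in> upper_half_plane \<Longrightarrow> f \<tau> = g (e \<tau>)"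
begin

text \<open>The radius is |q| on the line of imaginary part 1/2. Unlike the region above that line,
  the disc is compact, because it contains the cusp q = 0; so |g| attains a maximum on it.\<close>

private lemma e_in_disc: "Im \<tau> \<ge> 1 / 2 \<Longrightarrow> e \<tau> \<in> cball 0 (exp (- pi))"
  by (simp add: norm_e)

private lemma small_disc: "cball 0 (exp (- pi)) \<subseteq> (ball 0 1 :: complex set)"
proof -
  have "exp (- pi) < 1" by simp
  then show ?thesis by (simp add: cball_subset_ball_iff)
qed

private lemma max_on_small_disc:
  obtains x where "x \<in> cball 0 (exp (- pi))" "\<And>q. q \<in> cball 0 (exp (- pi)) \<Longrightarrow> norm (g q) \<le> norm (g x)"
proof -
  have "continuous_on (cball 0 (exp (- pi))) (\<lambda>q. norm (g q))"
    using continuous_on_subset[OF holomorphic_on_imp_continuous_on[OF g] small_disc]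
    by (rule continuous_on_norm)
  from continuous_attains_sup[OF compact_cball _ this] show ?thesis using that by auto
qed

lemma modular_weight_0_constant:
  assumes "n = 0" "\<tau> \<in> upper_half_plane" "\<tau>' \<in> upper_half_plane"
  shows "f \<tau> = f \<tau>'"
proof -
  obtain x where x: "x \<in> cball 0 (exp (- pi))" "\<And>q. q \<in> cball 0 (exp (- pi)) \<Longrightarrow> norm (g q) \<le> norm (g x)"
    using max_on_small_disc by blast
  have B: "norm (f \<tau>) \<le> norm (g x)" if "Im \<tau> \<ge> 1 / 2" for \<tau>
    using x(2)[OF e_in_disc[OF that]] fg[of \<tau>] that by (auto simp: upper_half_plane_def)
  have "norm (g q) \<le> norm (g x)" if q: "q \<in> ball 0 1" for q
  proof (cases "q = 0")
    case True
    then show ?thesis using x(2)[of 0] by simp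
  next
    case False
    then obtain t where t: "t \<in> upper_half_plane" "e t = q" using exists_e_preimage[of q] q by auto
    have "norm (f t) ^ 2 \<le> norm (g x) ^ 2 * (2 * Im t) ^ n"
      by (rule modular_weight_nonpos_bound[OF modular B t(1)])
    then have "norm (g q) ^ 2 \<le> norm (g x) ^ 2" using fg[OF t(1)] t(2) assms(1) by simp
    then show ?thesis by (rule power2_le_imp_le) simp
  qed
  then have "g constant_on ball 0 1"
    by (intro maximum_modulus_principle[OF g, of "ball 0 1" x]) (use x(1) small_disc in auto)
  then show ?thesis
    using assms norm_e_less_1 by (auto simp: constant_on_def fg)
qed

lemma modular_weight_neg_zero:
  assumes "n > 0" "\<tau> \<in> upper_half_plane"
  shows "f \<tau> = 0"
proof -
  obtain x where x: "x \<in> cball 0 (exp (- pi))" "\<And>q. q \<in> cball 0 (exp (- pi)) \<Longrightarrow> norm (g q) \<le> norm (g x)"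
    using max_on_small_disc by blast
  have B: "norm (f \<tau>) \<le> norm (g x)" if "Im \<tau> \<ge> 1 / 2" for \<tau>
    using x(2)[OF e_in_disc[OF that]] fg[of \<tau>] that by (auto simp: upper_half_plane_def)
  \<comment> \<open>The point \<tau> stays fixed while the circle |q| = exp (-2 pi y) widens towards
    the unit circle as y tends to 0. All points above this circle have imaginary part y, and the
    maximum principle carries the bound inwards.\<close>
  have bound: "norm (f \<tau>) \<le> sqrt (norm (g x) ^ 2 * (2 * y) ^ n)" if y: "0 < y" "y \<le> Im \<tau>" for y
  proof -
    let ?r = "exp (- 2 * pi * y)"
    have r: "?r < 1" using y by simp
    then have sub: "cball 0 ?r \<subseteq> (ball 0 1 :: complex set)" by (simp add: cball_subset_ball_iff)
    have "norm (g (e \<tau>)) \<le> sqrt (norm (g x) ^ 2 * (2 * y) ^ n)"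
    proof (rule maximum_modulus_frontier[of g "cball 0 ?r"])
      show "g holomorphic_on interior (cball 0 ?r)"
        by (rule holomorphic_on_subset[OF g order.trans[OF interior_subset sub]])
      show "continuous_on (closure (cball 0 ?r)) g"
        using continuous_on_subset[OF holomorphic_on_imp_continuous_on[OF g] sub] by simp
      show "e \<tau> \<in> cball 0 ?r" using y by (simp add: norm_e)
      fix q assume "q \<in> frontier (cball 0 ?r :: complex set)"
      then have q: "norm q = ?r" by (simp add: frontier_cball)
      then have "q \<noteq> 0" "norm q < 1" using r by (auto simp del: exp_less_one_iff)
      then obtain t where t: "t \<in> upper_half_plane" "e t = q" using exists_e_preimage by blast
      have "Im t = y" using norm_e[of t] t(2) q by simp
      then have "norm (f t) ^ 2 \<le> norm (g x) ^ 2 * (2 * y) ^ n"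
        using modular_weight_nonpos_bound[OF modular B t(1)] by simp
      then show "norm (g q) \<le> sqrt (norm (g x) ^ 2 * (2 * y) ^ n)"
        using fg[OF t(1)] t(2) by (intro real_le_rsqrt) simp
    qed auto
    then show ?thesis using fg[OF assms(2)] by simp
  qed
  have "((\<lambda>y. sqrt (norm (g x) ^ 2 * (2 * y) ^ n)) \<longlongrightarrow> sqrt (norm (g x) ^ 2 * (2 * 0) ^ n)) (at_right 0)"
    by (intro tendsto_intros)
  then have lim: "((\<lambda>y. sqrt (norm (g x) ^ 2 * (2 * y) ^ n)) \<longlongrightarrow> 0) (at_right 0)"
    using assms(1) by (simp add: zero_power)
  have "eventually (\<lambda>y. norm (f \<tau>) \<le> sqrt (norm (g x) ^ 2 * (2 * y) ^ n)) (at_right 0)"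
    using bound assms(2) unfolding eventually_at_right_field upper_half_plane_def
    by (intro exI[of _ "Im \<tau>"]) auto
  then have "norm (f \<tau>) \<le> 0" by (rule tendsto_lowerbound[OF lim]) simp
  then show ?thesis by simp
qed

end

section \<open>Taylor coefficients of functions with a q-expansion\<close>

text \<open>Cauchy's inequality, arranged so that \<open>h\<close> has to be bounded on a single
  circle only, which corresponds to one horizontal line in \<tau>.\<close>

lemma power_series_coeff_bound:
  fixes a :: "nat \<Rightarrow> complex"
  assumes sums: "\<And>w. w \<in> ball 0 1 \<Longrightarrow> (\<lambda>n. a n * w ^ n) sums h w"
    and r: "0 < r" "r < 1" and M: "\<And>w. norm w = r \<Longrightarrow> norm (h w) \<le> M"
  shows "norm (a n) \<le> M / r ^ n"
proof -
  define H where "H = eval_fps (Abs_fps a)"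
  have H: "H w = h w" if "w \<in> ball 0 1" for w
    using sums_unique[OF sums[OF that]] by (simp add: H_def eval_fps_def)
  have hol: "H holomorphic_on ball 0 1"
    by (rule power_series_holomorphic[of 0 1 a]) (use sums H in auto)
  \<comment> \<open>Any nonzero point of the disc would do: convergence there makes the radius of
    convergence positive.\<close>
  have "norm (1 / 2 :: complex) \<le> conv_radius a"
    by (rule conv_radius_geI) (use sums[of "1 / 2"] in \<open>auto intro: sums_summable simp: dist_norm\<close>)
  moreover have "(0 :: ereal) < norm (1 / 2 :: complex)" by simp
  ultimately have "conv_radius a > 0" by (rule less_le_trans[rotated])
  then have "fps_conv_radius (Abs_fps a) > 0" by (simp add: fps_conv_radius_def)
  then have a: "a n = (deriv ^^ n) H 0 / fact n"
    using fps_nth_conv_deriv[of "Abs_fps a" n] by (simp add: H_def)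
  have "norm ((deriv ^^ n) H 0) \<le> fact n * M / r ^ n"
  proof (rule Cauchy_inequality)
    have sub: "cball 0 r \<subseteq> (ball 0 1 :: complex set)" using r by (simp add: cball_subset_ball_iff)
    show "continuous_on (cball 0 r) H"
      by (rule continuous_on_subset[OF holomorphic_on_imp_continuous_on[OF hol] sub])
    show "H holomorphic_on ball 0 r"
      by (rule holomorphic_on_subset[OF hol]) (use r in auto)
    show "norm (H x) \<le> M" if "norm (0 - x) = r" for x
      using M[of x] H[of x] that r by simp
  qed (use r in auto)
  then have "norm ((deriv ^^ n) H 0) / fact n \<le> fact n * M / r ^ n / fact n"
    by (rule divide_right_mono) simp
  then show ?thesis by (simp add: a norm_divide)
qed

text \<open>An integer translation bounds the real part, so a circle in q is the image of a compact
  segment.\<close>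

lemma exists_e_preimage_strip:
  assumes "w \<noteq> 0" "norm w < 1"
  obtains \<tau> where "\<tau> \<in> upper_half_plane" "e \<tau> = w" "\<bar>Re \<tau>\<bar> \<le> 1"
proof -
  obtain t where t: "t \<in> upper_half_plane" "e t = w" using exists_e_preimage[OF assms] .
  let ?s = "t - of_int \<lfloor>Re t\<rfloor>"
  have "e ?s = w" using e_add[of ?s "of_int \<lfloor>Re t\<rfloor>"] t(2) by simp
  moreover have "?s \<in> upper_half_plane" using t(1) by (simp add: upper_half_plane_def)
  moreover have "\<bar>Re ?s\<bar> \<le> 1" using floor_correct[of "Re t"] by simp linarith
  ultimately show ?thesis using that by blast
qed

lemma higher_deriv_sum_mult:
  fixes P :: "nat \<Rightarrow> complex \<Rightarrow> complex"
  assumes "\<And>n. P n holomorphic_on UNIV"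
  shows "(deriv ^^ j) (\<lambda>z. \<Sum>n<N. P n z * c n) 0 = (\<Sum>n<N. (deriv ^^ j) (P n) 0 * c n)"
proof (induction N)
  case (Suc N)
  have "(deriv ^^ j) (\<lambda>z. (\<Sum>n<N. P n z * c n) + c N * P N z) 0 =
      (deriv ^^ j) (\<lambda>z. \<Sum>n<N. P n z * c n) 0 + (deriv ^^ j) (\<lambda>z. c N * P N z) 0"
    by (rule higher_deriv_add[of _ UNIV]) (auto intro!: holomorphic_intros assms)
  also have "(deriv ^^ j) (\<lambda>z. c N * P N z) 0 = c N * (deriv ^^ j) (P N) 0"
    by (rule higher_deriv_cmult[of _ UNIV]) (auto intro!: assms)
  finally show ?case using Suc.IH by (simp add: mult.commute)
qed auto

text \<open>The Cauchy bounds on \<open>P n z\<close> are uniform for |z| \<le> 1, so at each fixed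
  \<tau> the series converges uniformly in z and may be differentiated termwise. The numbers
  obtained at z = 0 are the coefficients of \<open>g\<close>; thus holomorphy in q comes from
  boundedness of \<open>F\<close> alone, with no regularity of \<open>F\<close> in \<tau>.\<close>

lemma higher_deriv_q_expansion:
  fixes F :: "complex \<Rightarrow> complex \<Rightarrow> complex" and P :: "nat \<Rightarrow> complex \<Rightarrow> complex"
  assumes P: "\<And>n. P n holomorphic_on UNIV"
    and sums: "\<And>\<tau> z. \<tau> \<in> upper_half_plane \<Longrightarrow> (\<lambda>n. P n z * e \<tau> ^ n) sums F \<tau> z"
    and bound: "\<And>y. y > 0 \<Longrightarrow>
      \<exists>M. \<forall>\<tau> z. Im \<tau> = y \<longrightarrow> \<bar>Re \<tau>\<bar> \<le> 1 \<longrightarrow> norm z \<le> 1 \<longrightarrow> norm (F \<tau> z) \<le> M"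
  obtains g where "g holomorphic_on ball 0 1"
    "\<And>\<tau>. \<tau> \<in> upper_half_plane \<Longrightarrow> (deriv ^^ j) (F \<tau>) 0 = g (e \<tau>)"
proof -
  have sums_disc: "(\<lambda>n. P n z * w ^ n) sums (\<Sum>n. P n z * w ^ n)" if w: "w \<in> ball 0 1" for w z
  proof (cases "w = 0")
    case False
    then obtain t where "t \<in> upper_half_plane" "e t = w" using w exists_e_preimage[of w] by auto
    then show ?thesis using sums by (metis sums_summable summable_sums)
  qed (simp add: powser_sums_zero)
  have coeff: "\<exists>M. \<forall>n z. norm z \<le> 1 \<longrightarrow> norm (P n z) \<le> M / r ^ n" if r: "0 < r" "r < 1" for r
  proof -
    \<comment> \<open>The height of the line on which \<open>e \<tau>\<close> has modulus
      \<open>r\<close>.\<close>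
    have "- ln r / (2 * pi) > 0" using r by (intro divide_pos_pos) auto
    then obtain M where M: "\<And>\<tau> z. Im \<tau> = - ln r / (2 * pi) \<Longrightarrow> \<bar>Re \<tau>\<bar> \<le> 1 \<Longrightarrow> norm z \<le> 1 \<Longrightarrow> norm (F \<tau> z) \<le> M"
      using bound by meson
    have "norm (P n z) \<le> M / r ^ n" if z: "norm z \<le> 1" for n z
    proof (rule power_series_coeff_bound[OF sums_disc r])
      fix w :: complex assume w: "norm w = r"
      then have "w \<noteq> 0" "norm w < 1" using r by auto
      then obtain t where t: "t \<in> upper_half_plane" "e t = w" "\<bar>Re t\<bar> \<le> 1"
        using exists_e_preimage_strip by blast
      have "r = exp (- 2 * pi * Im t)" using norm_e[of t] t(2) w by simp
      then have "ln r = - 2 * pi * Im t" by simp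
      then have "Im t = - ln r / (2 * pi)" by simp
      then have "norm (F t z) \<le> M" using M t(3) z by blast
      moreover have "(\<Sum>n. P n z * w ^ n) = F t z" using sums[OF t(1), of z] t(2) by (simp add: sums_iff)
      ultimately show "norm (\<Sum>n. P n z * w ^ n) \<le> M" by simp
    qed
    then show ?thesis by blast
  qed
  have deriv_sums: "(\<lambda>n. (deriv ^^ j) (P n) 0 * e \<tau> ^ n) sums (deriv ^^ j) (F \<tau>) 0"
    if tau: "\<tau> \<in> upper_half_plane" for \<tau>
  proof -
    let ?q = "e \<tau>"
    have q: "norm ?q < 1" by (rule norm_e_less_1[OF tau])
    \<comment> \<open>A radius strictly between |q| and 1, which makes the majorant geometric with
      ratio |q| / r < 1.\<close>
    define r where "r = (1 + norm ?q) / 2"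
    have r: "0 < r" "r < 1" "norm ?q < r" using q by (auto simp: r_def intro: add_pos_nonneg)
    obtain M where M: "\<And>n z. norm z \<le> 1 \<Longrightarrow> norm (P n z) \<le> M / r ^ n" using coeff[OF r(1,2)] by blast
    have "uniform_limit (ball 0 1) (\<lambda>N z. \<Sum>n<N. P n z * ?q ^ n) (\<lambda>z. \<Sum>n. P n z * ?q ^ n) sequentially"
    proof (rule Weierstrass_m_test)
      fix n z assume "z \<in> ball (0::complex) 1"
      then have "norm (P n z) \<le> M / r ^ n" by (intro M) simp
      then have "norm (P n z) * norm ?q ^ n \<le> M / r ^ n * norm ?q ^ n"
        by (rule mult_right_mono) simp
      then show "norm (P n z * ?q ^ n) \<le> M * (norm ?q / r) ^ n"
        by (simp add: norm_mult norm_power power_divide)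
    next
      show "summable (\<lambda>n. M * (norm ?q / r) ^ n)"
        using r by (intro summable_mult summable_geometric) auto
    qed
    moreover have "(\<lambda>z. \<Sum>n. P n z * ?q ^ n) = F \<tau>"
      using sums[OF tau] by (auto simp: sums_iff)
    ultimately have ul: "uniform_limit (ball 0 1) (\<lambda>N z. \<Sum>n<N. P n z * ?q ^ n) (F \<tau>) sequentially" by simp
    have "(\<lambda>N. (deriv ^^ j) (\<lambda>z. \<Sum>n<N. P n z * ?q ^ n) 0) \<longlonglongrightarrow> (deriv ^^ j) (F \<tau>) 0"
      by (rule higher_deriv_complex_uniform_limit[OF ul])
         (auto intro!: always_eventually holomorphic_intros holomorphic_on_subset[OF P])
    then show ?thesis unfolding higher_deriv_sum_mult[OF P] sums_def .
  qed
  define g where "g = (\<lambda>w. \<Sum>n. (deriv ^^ j) (P n) 0 * w ^ n)"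
  have "g holomorphic_on ball 0 1"
  proof (rule power_series_holomorphic)
    fix w :: complex assume w: "w \<in> ball 0 1"
    show "(\<lambda>n. (deriv ^^ j) (P n) 0 * (w - 0) ^ n) sums g w"
    proof (cases "w = 0")
      case True
      then show ?thesis by (simp add: g_def powser_sums_zero)
    next
      case False
      then obtain t where "t \<in> upper_half_plane" "e t = w" using w exists_e_preimage[of w] by auto
      then show ?thesis using deriv_sums[of t] by (simp add: g_def sums_iff)
    qed
  qed
  moreover have "(deriv ^^ j) (F \<tau>) 0 = g (e \<tau>)" if "\<tau> \<in> upper_half_plane" for \<tau>
    using deriv_sums[OF that] by (simp add: g_def sums_iff)
  ultimately show ?thesis using that by blast
qed

section \<open>Vanishing orders in \<open>J_space\<close>\<close>

lemma open_domain: "open (upper_half_plane \<times> (UNIV :: complex set))"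
  unfolding upper_half_plane_def by (intro open_Times open_halfspace_Im_gt open_UNIV)

lemma psi_one:
  assumes "\<tau> \<in> upper_half_plane"
  shows "psi 1 (lattice \<tau> 1) = - 1"
proof -
  have "1 \<notin> (\<lambda>w. 2 * w) ` lattice \<tau> 1"
  proof
    assume "1 \<in> (\<lambda>w. 2 * w) ` lattice \<tau> 1"
    then obtain w where "w \<in> lattice \<tau> 1" "1 = 2 * w" by blast
    moreover from this have "w = 1 / 2" by (simp add: field_simps)
    ultimately show False using half_lattice_distance(3)[OF assms] by simp
  qed
  then show ?thesis by (simp add: psi_def)
qed

lemma psi_tau:
  assumes "\<tau> \<in> upper_half_plane"
  shows "psi \<tau> (lattice \<tau> 1) = - 1"
proof -
  have "\<tau> \<notin> (\<lambda>w. 2 * w) ` lattice \<tau> 1"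
  proof
    assume "\<tau> \<in> (\<lambda>w. 2 * w) ` lattice \<tau> 1"
    then obtain w where w: "w \<in> lattice \<tau> 1" "\<tau> = 2 * w" by blast
    obtain a b :: int where "w = of_int a * \<tau> + of_int b" using w(1) unfolding lattice_iff by blast
    then have ab: "\<tau> = 2 * (of_int a * \<tau> + of_int b)" using w(2) by argo
    have "Im \<tau> = 2 * of_int a * Im \<tau>" using arg_cong[OF ab, of Im] by simp
    then have "real_of_int (2 * a) = 1" using assms by (simp add: upper_half_plane_def)
    then have "2 * a = 1" unfolding of_int_eq_1_iff .
    then show False by presburger
  qed
  then show ?thesis by (simp add: psi_def)
qed

text \<open>The weight is written as \<open>- int K\<close> with a natural number, so that the
  automorphy factors become ordinary powers.\<close>

locale weak_jacobi =
  fixes \<phi> :: "complex \<times> complex \<Rightarrow> complex" and K :: nat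
  assumes J: "\<phi> \<in> J_space (- int K)"
begin

lemma holo2: "holomorphic2_on \<phi> (upper_half_plane \<times> UNIV)"
  using J by (simp add: J_space_def)

lemma continuous: "continuous_on (upper_half_plane \<times> UNIV) \<phi>"
  using holo2 unfolding holomorphic2_on_def
  by (meson has_derivative_continuous continuous_on_eq_continuous_within)

lemma entire:
  assumes "\<tau> \<in> upper_half_plane"
  shows "(\<lambda>z. \<phi> (\<tau>, z)) holomorphic_on S"
proof -
  have "(\<lambda>z. \<phi> (\<tau>, z)) holomorphic_on UNIV"
    unfolding holomorphic_on_open[OF open_UNIV]
  proof
    fix z :: complex
    obtain a b where "(\<phi> has_derivative (\<lambda>h. a * fst h + b * snd h)) (at (\<tau>, z) within upper_half_plane \<times> UNIV)"
      using holo2 assms unfolding holomorphic2_on_def by blast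
    then have "(\<phi> has_derivative (\<lambda>h. a * fst h + b * snd h)) (at (\<tau>, z))"
      using at_within_open[OF _ open_domain] assms by simp
    moreover have "((\<lambda>z. (\<tau>, z)) has_derivative (\<lambda>h. (0, h))) (at z)"
      by (auto intro!: derivative_eq_intros)
    ultimately have "((\<lambda>z. \<phi> (\<tau>, z)) has_derivative (\<lambda>h. a * fst (0::complex, h) + b * snd (0::complex, h))) (at z)"
      using has_derivative_compose by blast
    then have "((\<lambda>z. \<phi> (\<tau>, z)) has_field_derivative b) (at z)"
      by (simp add: has_field_derivative_def)
    then show "\<exists>f'. ((\<lambda>z. \<phi> (\<tau>, z)) has_field_derivative f') (at z)" by blast
  qed
  then show ?thesis by (rule holomorphic_on_subset) simp
qed

lemma modular:
  fixes a b c d :: int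
  assumes det: "a * d - b * c = 1" and tau: "\<tau> \<in> upper_half_plane"
  shows "(of_int c * \<tau> + of_int d) ^ K *
    \<phi> ((of_int a * \<tau> + of_int b) / (of_int c * \<tau> + of_int d), z / (of_int c * \<tau> + of_int d)) = \<phi> (\<tau>, z)"
proof -
  define M :: "int^2^2" where "M = vector [vector [a, b], vector [c, d]]"
  have M: "M $ 1 $ 1 = a" "M $ 1 $ 2 = b" "M $ 2 $ 1 = c" "M $ 2 $ 2 = d"
    by (simp_all add: M_def)
  have "M \<in> SL2Z" using det by (simp add: SL2Z_def det_2 M)
  then have "slash_mat \<phi> (- int K) M (\<tau>, z) = \<phi> (\<tau>, z)"
    using J tau by (auto simp: J_space_def)
  then show ?thesis by (simp add: slash_mat_def M Let_def)
qed

lemma quasi_periodic: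
  assumes tau: "\<tau> \<in> upper_half_plane"
  shows "\<phi> (\<tau>, z + 1) = (- exp (eta 1 (lattice \<tau> 1) * (z + 1 / 2))) ^ K * \<phi> (\<tau>, z)"
    and "\<phi> (\<tau>, z + \<tau>) = (- exp (eta \<tau> (lattice \<tau> 1) * (z + \<tau> / 2))) ^ K * \<phi> (\<tau>, z)"
proof -
  have X: "slash_vec \<phi> (- int K) X (\<tau>, z) = \<phi> (\<tau>, z)" for X
    using J tau unfolding J_space_def by blast
  have "inverse ((- exp (eta 1 (lattice \<tau> 1) * (z + 1 / 2))) ^ K) * \<phi> (\<tau>, z + 1) = \<phi> (\<tau>, z)"
    using X[of "(0, 1)"] by (simp add: slash_vec_def Let_def psi_one[OF tau] power_int_minus)
  then show "\<phi> (\<tau>, z + 1) = (- exp (eta 1 (lattice \<tau> 1) * (z + 1 / 2))) ^ K * \<phi> (\<tau>, z)"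
    by (metis (no_types, lifting) exp_not_eq_zero left_inverse mult.assoc mult.commute mult.right_neutral neg_equal_0_iff_equal power_not_zero)
  have "inverse ((- exp (eta \<tau> (lattice \<tau> 1) * (z + \<tau> / 2))) ^ K) * \<phi> (\<tau>, z + \<tau>) = \<phi> (\<tau>, z)"
    using X[of "(1, 0)"] by (simp add: slash_vec_def Let_def psi_tau[OF tau] power_int_minus)
  then show "\<phi> (\<tau>, z + \<tau>) = (- exp (eta \<tau> (lattice \<tau> 1) * (z + \<tau> / 2))) ^ K * \<phi> (\<tau>, z)"
    by (metis (no_types, lifting) exp_not_eq_zero left_inverse mult.assoc mult.commute mult.right_neutral neg_equal_0_iff_equal power_not_zero)
qed

section \<open>The normalised function \<open>F\<close> and its multipliers\<close>

definition F :: "complex \<Rightarrow> complex \<Rightarrow> complex" where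
  "F \<tau> z = rho \<tau> z powi (- int K) * \<phi> (\<tau>, z)"

lemma rho_powi: "rho \<tau> z powi (- int K) = exp (- (of_nat K * (eta 1 (lattice \<tau> 1) * z\<^sup>2 / 2 - of_real pi * \<i> * z)))"
  by (simp add: rho_def power_int_minus exp_minus exp_of_nat_mult)

lemma rho_nonzero: "rho \<tau> z \<noteq> 0"
  by (simp add: rho_def)

lemma rho_powi_entire: "(\<lambda>z. rho \<tau> z powi (- int K)) holomorphic_on S"
  unfolding rho_powi by (intro holomorphic_intros) auto

lemma F_entire: "\<tau> \<in> upper_half_plane \<Longrightarrow> F \<tau> holomorphic_on S"
  unfolding F_def[abs_def] by (intro holomorphic_on_mult rho_powi_entire entire)

lemma F_add_1:
  assumes tau: "\<tau> \<in> upper_half_plane"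
  shows "F \<tau> (z + 1) = F \<tau> z"
proof -
  let ?w = "- exp (eta 1 (lattice \<tau> 1) * (z + 1 / 2))"
  have "rho \<tau> (z + 1) = exp (eta 1 (lattice \<tau> 1) * z\<^sup>2 / 2 - of_real pi * \<i> * z +
      eta 1 (lattice \<tau> 1) * (z + 1 / 2) - of_real pi * \<i>)"
    unfolding rho_def by (rule arg_cong[of _ _ exp]) (simp add: power2_eq_square field_simps)
  also have "\<dots> = rho \<tau> z * ?w"
    by (simp add: rho_def exp_add exp_diff)
  finally have "rho \<tau> (z + 1) = rho \<tau> z * ?w" .
  then have "rho \<tau> (z + 1) powi (- int K) = rho \<tau> z powi (- int K) * inverse (?w ^ K)"
    by (simp only: power_int_minus power_int_of_nat power_mult_distrib inverse_mult_distrib)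
  then have "F \<tau> (z + 1) = rho \<tau> z powi (- int K) * (inverse (?w ^ K) * ?w ^ K) * \<phi> (\<tau>, z)"
    unfolding F_def quasi_periodic(1)[OF tau] by (simp only: mult.assoc)
  also have "inverse (?w ^ K) * ?w ^ K = 1" by simp
  finally show ?thesis by (simp add: F_def)
qed

lemma F_add_tau:
  assumes tau: "\<tau> \<in> upper_half_plane"
  shows "F \<tau> (z + \<tau>) = (- e (- z)) ^ K * F \<tau> z"
proof -
  let ?h = "eta 1 (lattice \<tau> 1)"
  let ?w = "- exp (eta \<tau> (lattice \<tau> 1) * (z + \<tau> / 2))"
  have exp_quot: "inverse (exp y) * - exp x = - exp (x - y)" for x y :: complex
    by (simp add: exp_diff field_simps)
  let ?v = "exp (?h * (z * \<tau> + \<tau>\<^sup>2 / 2) - of_real pi * \<i> * \<tau>)"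
  have "rho \<tau> (z + \<tau>) = rho \<tau> z * ?v"
    unfolding rho_def exp_add[symmetric]
    by (rule arg_cong[of _ _ exp]) (simp add: power2_eq_square field_simps)
  then have "F \<tau> (z + \<tau>) = rho \<tau> z powi (- int K) * (inverse ?v ^ K * ?w ^ K) * \<phi> (\<tau>, z)"
    unfolding F_def quasi_periodic(2)[OF tau]
    by (simp add: power_int_minus power_mult_distrib power_inverse mult_ac)
  also have "inverse ?v ^ K * ?w ^ K = (inverse ?v * ?w) ^ K" by (rule power_mult_distrib[symmetric])
  also have "inverse ?v * ?w = - exp (eta \<tau> (lattice \<tau> 1) * (z + \<tau> / 2) - (?h * (z * \<tau> + \<tau>\<^sup>2 / 2) - of_real pi * \<i> * \<tau>))"
    by (rule exp_quot)
  \<comment> \<open>After the Legendre relation is inserted, all terms with the quasi-period cancel,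
    and the constant pi i \<tau> cancels against the linear part of the exponent of
    \<open>rho\<close>.\<close>
  also have "eta \<tau> (lattice \<tau> 1) * (z + \<tau> / 2) - (?h * (z * \<tau> + \<tau>\<^sup>2 / 2) - of_real pi * \<i> * \<tau>) = 2 * of_real pi * \<i> * (- z)"
    unfolding legendre_relation[OF tau] by (simp add: power2_eq_square field_simps)
  finally show ?thesis by (simp add: F_def e_def mult_ac)
qed

lemma eq_0_if_vanishing_order_gt:
  assumes tau: "\<tau> \<in> upper_half_plane"
    and van: "\<And>i. i \<le> K \<Longrightarrow> (deriv ^^ i) (\<lambda>z. \<phi> (\<tau>, z)) 0 = 0"
  shows "\<phi> (\<tau>, z) = 0"
proof (cases "\<forall>n. (deriv ^^ n) (\<lambda>z. \<phi> (\<tau>, z)) 0 = 0")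
  case True
  show ?thesis
    by (rule holomorphic_fun_eq_0_on_connected[OF entire[OF tau] open_UNIV connected_UNIV, of 0]) (use True in auto)
next
  case False
  let ?f = "\<lambda>z. \<phi> (\<tau>, z)"
  define n where "n = (LEAST n. (deriv ^^ n) ?f 0 \<noteq> 0)"
  have n: "(deriv ^^ n) ?f 0 \<noteq> 0" using False LeastI_ex[of "\<lambda>n. (deriv ^^ n) ?f 0 \<noteq> 0"] by (auto simp: n_def)
  have less_n: "(deriv ^^ i) ?f 0 = 0" if "i < n" for i
    using not_less_Least[of i "\<lambda>n. (deriv ^^ n) ?f 0 \<noteq> 0"] that by (auto simp: n_def)
  have nK: "n > K" using n van[of n] by (meson not_less)
  obtain g r where r: "r > 0" and g: "g holomorphic_on ball 0 r"
    and fac: "\<And>w. w \<in> ball 0 r \<Longrightarrow> ?f w - ?f 0 = (w - 0) ^ n * g w"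
    and nz: "\<And>w. w \<in> ball 0 r \<Longrightarrow> g w \<noteq> 0"
    using holomorphic_factor_order_of_zero[OF entire[OF tau, of UNIV] open_UNIV UNIV_I, of n 0] nK n less_n
    by (metis (no_types, lifting) gr_zeroI not_less0)
  have f0: "?f 0 = 0" using less_n[of 0] nK by simp
  obtain T where T: "T holomorphic_on UNIV" "T 0 \<noteq> 0" "\<And>z. theta \<tau> z = z * T z"
    using theta_simple_zero[OF tau] by blast
  define h where "h = (\<lambda>z. F \<tau> z / theta \<tau> z ^ K)"
  \<comment> \<open>Near 0 the numerator is z^n times a holomorphic factor and the denominator is (z
    T)^K, so a positive power of z survives in the quotient.\<close>
  have "((\<lambda>z. z ^ (n - K) * (rho \<tau> z powi (- int K) * g z / T z ^ K)) \<longlongrightarrow>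
      0 ^ (n - K) * (rho \<tau> 0 powi (- int K) * g 0 / T 0 ^ K)) (at 0)"
  proof (intro tendsto_mult tendsto_divide tendsto_power tendsto_ident_at)
    have "continuous_on UNIV (\<lambda>z. rho \<tau> z powi (- int K))"
      by (rule holomorphic_on_imp_continuous_on[OF rho_powi_entire])
    then show "((\<lambda>z. rho \<tau> z powi (- int K)) \<longlongrightarrow> rho \<tau> 0 powi (- int K)) (at 0)"
      by (simp add: continuous_on_eq_continuous_at isCont_def)
    show "(g \<longlongrightarrow> g 0) (at 0)"
      using holomorphic_on_imp_continuous_on[OF g] r by (simp add: continuous_on_eq_continuous_at isCont_def)
    show "(T \<longlongrightarrow> T 0) (at 0)"
      using holomorphic_on_imp_continuous_on[OF T(1)] by (simp add: continuous_on_eq_continuous_at isCont_def)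
    show "T 0 ^ K \<noteq> 0" using T(2) by simp
  qed
  then have "((\<lambda>z. z ^ (n - K) * (rho \<tau> z powi (- int K) * g z / T z ^ K)) \<longlongrightarrow> 0) (at 0)"
    using nK by (simp add: zero_power)
  moreover have "eventually (\<lambda>z. z ^ (n - K) * (rho \<tau> z powi (- int K) * g z / T z ^ K) = h z) (at 0)"
    unfolding eventually_at
  proof (intro exI[of _ r] conjI r ballI impI)
    fix w :: complex assume w: "w \<noteq> 0 \<and> dist w 0 < r"
    then have "?f w = w ^ n * g w" using fac[of w] f0 by simp
    moreover have "w ^ n = w ^ (n - K) * w ^ K" using nK by (simp add: power_add[symmetric])
    ultimately show "w ^ (n - K) * (rho \<tau> w powi (- int K) * g w / T w ^ K) = h w"
      using w by (simp add: h_def F_def T(3) power_mult_distrib)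
  qed
  ultimately have lim: "(h \<longlongrightarrow> 0) (at 0)" by (rule Lim_transform_eventually)
  have h_hol: "h holomorphic_on - lattice \<tau> 1"
    unfolding h_def using theta_nonzero[OF tau]
    by (intro holomorphic_on_divide F_entire[OF tau] holomorphic_on_power theta_holomorphic[OF tau]) auto
  have h1: "h (z + 1) = h z" for z
    by (simp add: h_def F_add_1[OF tau] theta_add_1)
  have h2: "h (z + \<tau>) = h z" for z
  proof -
    have "(- e (- z)) ^ K \<noteq> 0" by simp
    then show ?thesis
      unfolding h_def F_add_tau[OF tau] theta_add_tau[OF tau] power_mult_distrib
      by (rule mult_divide_mult_cancel_left)
  qed
  have h0: "h z = 0" if "z \<notin> lattice \<tau> 1" for z
    by (rule elliptic_const[OF tau h_hol h1 h2 lim that])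
  \<comment> \<open>A point other than 0 so close to 0 that it lies off the lattice and inside the
    disc where \<open>g\<close> has no zero; the vanishing of \<open>h\<close> there contradicts the
    local factorisation.\<close>
  define d where "d = min r (1 / lattice_const \<tau>)"
  have d: "d > 0" using r lattice_const_pos[OF tau] by (simp add: d_def)
  define w :: complex where "w = of_real (d / 2)"
  have "norm w = d / 2" using d by (simp add: w_def)
  moreover have "d \<le> r" "d \<le> 1 / lattice_const \<tau>" by (simp_all add: d_def)
  ultimately have w: "w \<noteq> 0" "norm w < r" "norm w < 1 / lattice_const \<tau>" using d by auto
  then have "w \<notin> lattice \<tau> 1" using lattice_inter_ball[OF tau, of w] by auto
  then have "?f w = 0"
    using h0[of w] theta_nonzero[OF tau, of w] rho_nonzero by (simp add: h_def F_def power_int_eq_0_iff)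
  then have False using fac[of w] nz[of w] f0 w by simp
  then show ?thesis ..
qed

end

section \<open>Taylor coefficients at z = 0 as modular forms\<close>

context weak_jacobi
begin

definition taylor :: "nat \<Rightarrow> complex \<Rightarrow> complex" where
  "taylor j \<tau> = (deriv ^^ j) (\<lambda>z. \<phi> (\<tau>, z)) 0"

text \<open>The action divides z by c\<tau> + d, so the chain rule contributes \<open>j\<close>
  inverse factors to the K-th power. With \<open>j \<le> K\<close> the remaining exponent is a
  natural number, as the results on weight -n expect.\<close>

lemma taylor_modular:
  fixes a b c d :: int
  assumes det: "a * d - b * c = 1" and tau: "\<tau> \<in> upper_half_plane" and j: "j \<le> K"
  shows "taylor j ((of_int a * \<tau> + of_int b) / (of_int c * \<tau> + of_int d)) * (of_int c * \<tau> + of_int d) ^ (K - j) =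
    taylor j \<tau>"
proof -
  let ?w = "of_int c * \<tau> + of_int d" and ?t = "(of_int a * \<tau> + of_int b) / (of_int c * \<tau> + of_int d)"
  note M = Im_moebius[OF det tau]
  have ent: "(\<lambda>z. \<phi> (?t, z)) holomorphic_on UNIV" by (rule entire[OF M(3)])
  have comp: "(\<lambda>z. \<phi> (?t, inverse ?w * z)) holomorphic_on UNIV"
    by (rule holomorphic_on_compose_gen[of "\<lambda>z. inverse ?w * z" UNIV "\<lambda>z. \<phi> (?t, z)" UNIV, unfolded o_def])
       (auto intro!: holomorphic_intros ent)
  have "(\<lambda>z. \<phi> (\<tau>, z)) = (\<lambda>z. ?w ^ K * \<phi> (?t, inverse ?w * z))"
    using modular[OF det tau] by (simp add: divide_inverse mult.commute)
  then have "taylor j \<tau> = (deriv ^^ j) (\<lambda>z. ?w ^ K * \<phi> (?t, inverse ?w * z)) 0"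
    unfolding taylor_def by (rule arg_cong)
  also have "\<dots> = ?w ^ K * (deriv ^^ j) (\<lambda>z. \<phi> (?t, inverse ?w * z)) 0"
    by (rule higher_deriv_cmult[OF comp]) auto
  also have "(deriv ^^ j) (\<lambda>z. \<phi> (?t, inverse ?w * z)) 0 = inverse ?w ^ j * (deriv ^^ j) (\<lambda>z. \<phi> (?t, z)) (inverse ?w * 0)"
    by (rule higher_deriv_compose_linear[OF ent, of UNIV]) auto
  also have "?w ^ K = ?w ^ (K - j) * ?w ^ j" using j by (simp add: power_add[symmetric])
  also have "?w ^ (K - j) * ?w ^ j * (inverse ?w ^ j * (deriv ^^ j) (\<lambda>z. \<phi> (?t, z)) (inverse ?w * 0)) =
      (?w * inverse ?w) ^ j * (taylor j ?t * ?w ^ (K - j))"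
    unfolding taylor_def power_mult_distrib by simp
  also have "?w * inverse ?w = 1" using M(2) by simp
  finally show ?thesis by simp
qed

text \<open>The cusp condition at the identity matrix, with everything that multiplies q^n gathered
  into one Laurent polynomial in \<open>e z\<close>. It is entire because \<open>e\<close> has no
  zeros.\<close>

lemma F_expansion:
  obtains P :: "nat \<Rightarrow> complex \<Rightarrow> complex" where "\<And>n. P n holomorphic_on UNIV"
    "\<And>\<tau> z. \<tau> \<in> upper_half_plane \<Longrightarrow> (\<lambda>n. P n z * e \<tau> ^ n) sums F \<tau> z"
proof -
  have "mat 1 \<in> SL2Z" by (simp add: SL2Z_def)
  then obtain r0 where "has_expansion (- int K) (slash_mat \<phi> (- int K) (mat 1)) r0"
    using J unfolding J_space_def by blast
  then obtain c where c: "\<And>\<tau> z. \<tau> \<in> upper_half_plane \<Longrightarrow>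
      (\<lambda>n. \<Sum>r = - int (r0 n)..int (r0 n). c n r * e \<tau> ^ n * e z powi r) sums
        (rho \<tau> z powi (- int K) * slash_mat \<phi> (- int K) (mat 1) (\<tau>, z))"
    unfolding has_expansion_def by blast
  have id: "slash_mat \<phi> (- int K) (mat 1) (\<tau>, z) = \<phi> (\<tau>, z)" for \<tau> z
    by (simp add: slash_mat_def mat_def Let_def)
  define P where "P = (\<lambda>n z. \<Sum>r = - int (r0 n)..int (r0 n). c n r * e z powi r)"
  have "P n holomorphic_on UNIV" for n
    unfolding P_def by (intro holomorphic_intros) auto
  moreover have "(\<lambda>n. P n z * e \<tau> ^ n) sums F \<tau> z" if "\<tau> \<in> upper_half_plane" for \<tau> z
    using c[OF that, of z] by (simp add: id F_def P_def sum_distrib_left mult_ac)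
  ultimately show ?thesis using that by blast
qed

text \<open>Continuity and compactness bound \<phi>. For \<open>rho\<close> they are not at hand, as
  nothing is known about the continuity of the quasi-period in \<tau>, and the explicit estimate of
  \<open>eta 1\<close> is used instead.\<close>

lemma F_bound:
  assumes y: "y > 0"
  shows "\<exists>M. \<forall>\<tau> z. Im \<tau> = y \<longrightarrow> \<bar>Re \<tau>\<bar> \<le> 1 \<longrightarrow> norm z \<le> 1 \<longrightarrow> norm (F \<tau> z) \<le> M"
proof -
  let ?Q = "(\<lambda>x. Complex x y) ` {-1..1} \<times> cball (0 :: complex) 1"
  have "compact ?Q"
    unfolding Complex_eq by (intro compact_Times compact_continuous_image continuous_intros) auto
  moreover have "continuous_on ?Q \<phi>"
    by (rule continuous_on_subset[OF continuous]) (use y in \<open>auto simp: upper_half_plane_def\<close>)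
  ultimately have "bounded (\<phi> ` ?Q)" by (intro compact_imp_bounded compact_continuous_image)
  then obtain B where B: "\<And>p. p \<in> ?Q \<Longrightarrow> norm (\<phi> p) \<le> B" unfolding bounded_iff by blast
  \<comment> \<open>Dominates \<open>lattice_const \<tau>\<close> on the segment, where |\<tau>|
    \<le> 1 + y.\<close>
  define C where "C = 1 + (2 + y) / y"
  define E where "E = 4 + 2 * (C\<^sup>2 * (3 * C + C\<^sup>2) * (\<Sum>\<^sub>\<infinity>p\<in>- {(0, 0)}. 1 / height p ^ 3))"
  have "norm (F \<tau> z) \<le> exp (real K * (E / 2 + pi)) * B"
    if t: "Im \<tau> = y" "\<bar>Re \<tau>\<bar> \<le> 1" and z: "norm z \<le> 1" for \<tau> z
  proof -
    have tau: "\<tau> \<in> upper_half_plane" using t y by (simp add: upper_half_plane_def)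
    have "\<tau> = Complex (Re \<tau>) y" using t by (simp add: complex_eq_iff)
    then have "(\<tau>, z) \<in> ?Q" using t z by (auto simp: image_iff intro!: bexI[of _ "Re \<tau>"])
    then have phi: "norm (\<phi> (\<tau>, z)) \<le> B" by (rule B)
    have "norm \<tau> \<le> 1 + y" using cmod_le[of \<tau>] t y by simp
    then have "lattice_const \<tau> \<le> C"
      using t y by (simp add: lattice_const_def C_def divide_right_mono)
    then have eta: "norm (eta 1 (lattice \<tau> 1)) \<le> E" unfolding E_def by (rule norm_eta_1_le[OF tau])
    let ?x = "eta 1 (lattice \<tau> 1) * z\<^sup>2 / 2 - of_real pi * \<i> * z"
    have "norm ?x \<le> norm (eta 1 (lattice \<tau> 1) * z\<^sup>2 / 2) + norm (of_real pi * \<i> * z)"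
      by (rule norm_triangle_ineq4)
    also have "\<dots> = norm (eta 1 (lattice \<tau> 1)) * norm z ^ 2 / 2 + pi * norm z"
      by (simp add: norm_mult norm_divide norm_power)
    also have "\<dots> \<le> E * 1 / 2 + pi * 1"
      using eta z order.trans[OF norm_ge_zero eta] by (intro add_mono divide_right_mono mult_mono power_le_one) auto
    finally have "real K * norm ?x \<le> real K * (E / 2 + pi)" by (intro mult_left_mono) auto
    moreover have "norm (rho \<tau> z powi (- int K)) \<le> exp (real K * norm ?x)"
      unfolding rho_powi using norm_exp[of "- (of_nat K * ?x)"] by (simp add: norm_mult)
    ultimately have "norm (rho \<tau> z powi (- int K)) \<le> exp (real K * (E / 2 + pi))"
      using exp_le_cancel_iff order.trans by blast
    then show ?thesis
      unfolding F_def norm_mult using phi by (intro mult_mono) auto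
  qed
  then show ?thesis by blast
qed

text \<open>The factor \<open>\<rho>\<^sup>k\<close> is not holomorphic in \<open>\<tau>\<close> in any evident way, but it equals \<open>1\<close> at \<open>z = 0\<close>, so it does not
  affect the first nonvanishing Taylor coefficient.\<close>

lemma taylor_eq_F:
  assumes tau: "\<tau> \<in> upper_half_plane" and van: "\<And>i. i < j \<Longrightarrow> taylor i \<tau> = 0"
  shows "(deriv ^^ j) (F \<tau>) 0 = taylor j \<tau>"
proof -
  let ?f = "\<lambda>z. \<phi> (\<tau>, z)" and ?r = "\<lambda>z. rho \<tau> z powi (- int K)"
  have "(deriv ^^ j) (F \<tau>) 0 = (deriv ^^ j) (\<lambda>z. ?f z * ?r z) 0"
    unfolding F_def[abs_def] by (simp add: mult.commute)
  also have "\<dots> = (\<Sum>i = 0..j. of_nat (j choose i) * (deriv ^^ i) ?f 0 * (deriv ^^ (j - i)) ?r 0)"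
    by (rule higher_deriv_mult[OF entire[OF tau] rho_powi_entire, of UNIV]) auto
  also have "\<dots> = (\<Sum>i \<in> {j}. of_nat (j choose i) * (deriv ^^ i) ?f 0 * (deriv ^^ (j - i)) ?r 0)"
    by (rule sum.mono_neutral_right) (use van in \<open>auto simp: taylor_def\<close>)
  also have "\<dots> = taylor j \<tau>" by (simp add: taylor_def rho_def)
  finally show ?thesis .
qed

lemma taylor_q_expansion:
  assumes van: "\<And>i \<tau>. i < j \<Longrightarrow> \<tau> \<in> upper_half_plane \<Longrightarrow> taylor i \<tau> = 0"
  obtains g where "g holomorphic_on ball 0 1" "\<And>\<tau>. \<tau> \<in> upper_half_plane \<Longrightarrow> taylor j \<tau> = g (e \<tau>)"
proof -
  obtain P :: "nat \<Rightarrow> complex \<Rightarrow> complex" where P: "\<And>n. P n holomorphic_on UNIV"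
    "\<And>\<tau> z. \<tau> \<in> upper_half_plane \<Longrightarrow> (\<lambda>n. P n z * e \<tau> ^ n) sums F \<tau> z"
    using F_expansion by blast
  obtain g where g: "g holomorphic_on ball 0 1"
    "\<And>\<tau>. \<tau> \<in> upper_half_plane \<Longrightarrow> (deriv ^^ j) (F \<tau>) 0 = g (e \<tau>)"
    using higher_deriv_q_expansion[of P F j, OF P F_bound] by blast
  have "taylor j \<tau> = g (e \<tau>)" if "\<tau> \<in> upper_half_plane" for \<tau>
    using g(2)[OF that] taylor_eq_F[OF that, of j] van[OF _ that] by simp
  with g(1) show ?thesis using that by blast
qed

text \<open>Strong induction is forced: coefficient \<open>j\<close> is known to be a power series
  in q only after all lower ones vanish at every \<tau>. Its weight \<open>j - K\<close> is then
  negative.\<close>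

lemma taylor_eq_0: "j < K \<Longrightarrow> \<tau> \<in> upper_half_plane \<Longrightarrow> taylor j \<tau> = 0"
proof (induction j arbitrary: \<tau> rule: less_induct)
  case (less j)
  then have "taylor i \<tau> = 0" if "i < j" "\<tau> \<in> upper_half_plane" for i \<tau>
    using that by simp
  then obtain g where g: "g holomorphic_on ball 0 1" "\<And>\<tau>. \<tau> \<in> upper_half_plane \<Longrightarrow> taylor j \<tau> = g (e \<tau>)"
    using taylor_q_expansion[of j] by blast
  show ?case
    by (rule modular_weight_neg_zero[of "taylor j" "K - j", OF taylor_modular g]) (use less.prems in auto)
qed

lemma taylor_K_constant:
  assumes "\<tau> \<in> upper_half_plane" "\<tau>' \<in> upper_half_plane"
  shows "taylor K \<tau> = taylor K \<tau>'"
proof -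
  obtain g where g: "g holomorphic_on ball 0 1" "\<And>\<tau>. \<tau> \<in> upper_half_plane \<Longrightarrow> taylor K \<tau> = g (e \<tau>)"
    using taylor_q_expansion[of K] taylor_eq_0 by blast
  show ?thesis
    by (rule modular_weight_0_constant[of "taylor K" "K - K", OF taylor_modular g]) (use assms in auto)
qed

lemma eq_0_if_taylor_K_eq_0:
  assumes "taylor K \<i> = 0"
  shows "\<phi> = 0"
proof
  fix p :: "complex \<times> complex"
  obtain \<tau> z where p: "p = (\<tau>, z)" by (cases p)
  show "\<phi> p = 0 p"
  proof (cases "\<tau> \<in> upper_half_plane")
    case True
    \<comment> \<open>The coefficient is constant in \<tau>, so \<i> serves as an arbitrary base
      point.\<close>
    have "taylor K \<tau> = 0"
      using taylor_K_constant[OF True, of \<i>] assms by (simp add: upper_half_plane_def)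
    then have "taylor i \<tau> = 0" if "i \<le> K" for i
      using taylor_eq_0[OF _ True, of i] that by (cases "i = K") auto
    then show ?thesis
      using eq_0_if_vanishing_order_gt[OF True] by (simp add: p taylor_def)
  next
    case False
    then show ?thesis using J by (auto simp: J_space_def p)
  qed
qed

end

section \<open>The vector space \<open>J_space_bounded\<close>\<close>

lemma fun_scale_apply: "fun_scale x f p = x * f p"
  by (simp add: fun_scale_def)

lemma slash_mat_add: "slash_mat (f + g) k M = slash_mat f k M + slash_mat g k M"
  by (auto simp: slash_mat_def Let_def fun_eq_iff algebra_simps)

lemma slash_mat_scale: "slash_mat (fun_scale x f) k M = fun_scale x (slash_mat f k M)"
  by (auto simp: slash_mat_def Let_def fun_eq_iff fun_scale_def)

lemma slash_vec_add: "slash_vec (f + g) k X = slash_vec f k X + slash_vec g k X"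
  by (auto simp: slash_vec_def Let_def fun_eq_iff algebra_simps)

lemma slash_vec_scale: "slash_vec (fun_scale x f) k X = fun_scale x (slash_vec f k X)"
  by (auto simp: slash_vec_def Let_def fun_eq_iff fun_scale_def)

text \<open>Padding with zero coefficients, so that two expansions can be brought to a common range
  before they are added.\<close>

lemma has_expansion_mono:
  assumes "has_expansion k f r0" "\<And>n. r0 n \<le> r1 n"
  shows "has_expansion k f r1"
proof -
  obtain c where c: "\<And>\<tau> z. \<tau> \<in> upper_half_plane \<Longrightarrow>
      (\<lambda>n. \<Sum>r = - int (r0 n)..int (r0 n). c n r * e \<tau> ^ n * e z powi r) sums (rho \<tau> z powi k * f (\<tau>, z))"
    using assms(1) unfolding has_expansion_def by blast
  define c' where "c' = (\<lambda>n r. if r \<in> {- int (r0 n)..int (r0 n)} then c n r else 0)"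
  have eq: "(\<Sum>r = - int (r1 n)..int (r1 n). c' n r * e \<tau> ^ n * e z powi r) =
      (\<Sum>r = - int (r0 n)..int (r0 n). c n r * e \<tau> ^ n * e z powi r)" for n \<tau> z
  proof -
    have "(\<Sum>r = - int (r1 n)..int (r1 n). c' n r * e \<tau> ^ n * e z powi r) =
        (\<Sum>r = - int (r0 n)..int (r0 n). c' n r * e \<tau> ^ n * e z powi r)"
      by (rule sum.mono_neutral_right) (use assms(2)[of n] in \<open>auto simp: c'_def\<close>)
    then show ?thesis by (simp add: c'_def)
  qed
  show ?thesis
    unfolding has_expansion_def by (rule exI[of _ c']) (use c in \<open>simp add: eq\<close>)
qed

lemma has_expansion_add:
  assumes "has_expansion k f r0" "has_expansion k g r1"
  shows "has_expansion k (f + g) (\<lambda>n. max (r0 n) (r1 n))"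
proof -
  let ?r = "\<lambda>n. max (r0 n) (r1 n)"
  obtain c where c: "\<And>\<tau> z. \<tau> \<in> upper_half_plane \<Longrightarrow>
      (\<lambda>n. \<Sum>r = - int (?r n)..int (?r n). c n r * e \<tau> ^ n * e z powi r) sums (rho \<tau> z powi k * f (\<tau>, z))"
    using has_expansion_mono[OF assms(1), of ?r] unfolding has_expansion_def by auto
  obtain c' where c': "\<And>\<tau> z. \<tau> \<in> upper_half_plane \<Longrightarrow>
      (\<lambda>n. \<Sum>r = - int (?r n)..int (?r n). c' n r * e \<tau> ^ n * e z powi r) sums (rho \<tau> z powi k * g (\<tau>, z))"
    using has_expansion_mono[OF assms(2), of ?r] unfolding has_expansion_def by auto
  have "(\<lambda>n. \<Sum>r = - int (?r n)..int (?r n). (c n r + c' n r) * e \<tau> ^ n * e z powi r) sums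
      (rho \<tau> z powi k * (f + g) (\<tau>, z))" if "\<tau> \<in> upper_half_plane" for \<tau> z
    using sums_add[OF c[OF that, of z] c'[OF that, of z]]
    by (simp add: sum.distrib[symmetric] algebra_simps)
  then show ?thesis
    unfolding has_expansion_def by (intro exI[of _ "\<lambda>n r. c n r + c' n r"]) blast
qed

lemma has_expansion_scale:
  assumes "has_expansion k f r0"
  shows "has_expansion k (fun_scale x f) r0"
proof -
  obtain c where c: "\<And>\<tau> z. \<tau> \<in> upper_half_plane \<Longrightarrow>
      (\<lambda>n. \<Sum>r = - int (r0 n)..int (r0 n). c n r * e \<tau> ^ n * e z powi r) sums (rho \<tau> z powi k * f (\<tau>, z))"
    using assms unfolding has_expansion_def by blast
  have "(\<lambda>n. \<Sum>r = - int (r0 n)..int (r0 n). (x * c n r) * e \<tau> ^ n * e z powi r) sums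
      (rho \<tau> z powi k * fun_scale x f (\<tau>, z))" if "\<tau> \<in> upper_half_plane" for \<tau> z
    using sums_mult[OF c[OF that, of z], of x]
    by (simp add: sum_distrib_left fun_scale_def mult_ac)
  then show ?thesis
    unfolding has_expansion_def by (intro exI[of _ "\<lambda>n r. x * c n r"]) blast
qed

lemma admissible_max:
  assumes "admissible r0" "admissible r1"
  shows "admissible (\<lambda>n. max (r0 n) (r1 n))"
  unfolding admissible_def
proof
  show "incseq (\<lambda>n. max (r0 n) (r1 n))"
    using assms unfolding admissible_def incseq_def by (meson max.mono)
  have "(\<lambda>n. max (real (r0 n) / real n) (real (r1 n) / real n)) \<longlonglongrightarrow> max 0 0"
    using assms unfolding admissible_def by (intro tendsto_max) auto
  moreover have "max (real (r0 n) / real n) (real (r1 n) / real n) = real (max (r0 n) (r1 n)) / real n" for n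
    by (simp add: of_nat_max max_divide_distrib_right)
  ultimately show "(\<lambda>n. real (max (r0 n) (r1 n)) / real n) \<longlonglongrightarrow> 0" by simp
qed

lemma J_space_zero: "0 \<in> J_space k"
proof -
  have "has_expansion k 0 (\<lambda>_. 0)"
    unfolding has_expansion_def by (rule exI[of _ "\<lambda>_ _. 0"]) simp
  moreover have "slash_mat 0 k M = 0" "slash_vec 0 k X = 0" for M X
    by (auto simp: slash_mat_def slash_vec_def Let_def fun_eq_iff)
  moreover have "holomorphic2_on 0 S" for S
    unfolding holomorphic2_on_def zero_fun_def
    by (intro ballI exI[of _ 0]) (auto intro!: derivative_eq_intros)
  moreover have "admissible (\<lambda>_. 0)" by (simp add: admissible_def)
  ultimately show ?thesis unfolding J_space_def by auto
qed

lemma J_space_add: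
  assumes "f \<in> J_space k" "g \<in> J_space k"
  shows "f + g \<in> J_space k"
proof -
  have "holomorphic2_on (f + g) (upper_half_plane \<times> UNIV)"
    unfolding holomorphic2_on_def
  proof
    fix p assume p: "p \<in> upper_half_plane \<times> (UNIV :: complex set)"
    obtain a b where f: "(f has_derivative (\<lambda>h. a * fst h + b * snd h)) (at p within upper_half_plane \<times> UNIV)"
      using assms(1) p unfolding J_space_def holomorphic2_on_def by blast
    obtain a' b' where g: "(g has_derivative (\<lambda>h. a' * fst h + b' * snd h)) (at p within upper_half_plane \<times> UNIV)"
      using assms(2) p unfolding J_space_def holomorphic2_on_def by blast
    have "(f + g has_derivative (\<lambda>h. (a + a') * fst h + (b + b') * snd h)) (at p within upper_half_plane \<times> UNIV)"
      unfolding plus_fun_def by (rule has_derivative_eq_rhs[OF has_derivative_add[OF f g]]) (simp add: algebra_simps)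
    then show "\<exists>a b. (f + g has_derivative (\<lambda>h. a * fst h + b * snd h)) (at p within upper_half_plane \<times> UNIV)"
      by blast
  qed
  moreover have "\<exists>r0. admissible r0 \<and> has_expansion k (slash_mat (f + g) k M) r0" if M: "M \<in> SL2Z" for M
  proof -
    obtain r0 where r0: "admissible r0" "has_expansion k (slash_mat f k M) r0"
      using assms(1) M unfolding J_space_def by blast
    obtain r1 where r1: "admissible r1" "has_expansion k (slash_mat g k M) r1"
      using assms(2) M unfolding J_space_def by blast
    show ?thesis
      unfolding slash_mat_add
      by (intro exI[of _ "\<lambda>n. max (r0 n) (r1 n)"] conjI admissible_max[OF r0(1) r1(1)] has_expansion_add[OF r0(2) r1(2)])
  qed
  ultimately show ?thesis
    using assms unfolding J_space_def by (simp add: slash_mat_add slash_vec_add)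
qed

lemma J_space_scale:
  assumes "f \<in> J_space k"
  shows "fun_scale x f \<in> J_space k"
proof -
  have "holomorphic2_on (fun_scale x f) (upper_half_plane \<times> UNIV)"
    unfolding holomorphic2_on_def
  proof
    fix p assume p: "p \<in> upper_half_plane \<times> (UNIV :: complex set)"
    obtain a b where f: "(f has_derivative (\<lambda>h. a * fst h + b * snd h)) (at p within upper_half_plane \<times> UNIV)"
      using assms p unfolding J_space_def holomorphic2_on_def by blast
    have "(fun_scale x f has_derivative (\<lambda>h. (x * a) * fst h + (x * b) * snd h)) (at p within upper_half_plane \<times> UNIV)"
      unfolding fun_scale_def
      by (rule has_derivative_eq_rhs[OF has_derivative_mult_right[OF f]]) (simp add: algebra_simps)
    then show "\<exists>a b. (fun_scale x f has_derivative (\<lambda>h. a * fst h + b * snd h)) (at p within upper_half_plane \<times> UNIV)"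
      by blast
  qed
  moreover have "\<exists>r0. admissible r0 \<and> has_expansion k (slash_mat (fun_scale x f) k M) r0" if M: "M \<in> SL2Z" for M
  proof -
    obtain r0 where "admissible r0" "has_expansion k (slash_mat f k M) r0"
      using assms M unfolding J_space_def by blast
    then show ?thesis unfolding slash_mat_scale by (intro exI[of _ r0] conjI has_expansion_scale)
  qed
  ultimately show ?thesis
    using assms unfolding J_space_def by (simp add: slash_mat_scale slash_vec_scale fun_scale_apply)
qed

text \<open>The infimum on the left is attained at some index, and there the maximum is one of the
  two values. This makes the order condition stable under sums.\<close>

lemma INF_max_ge:
  assumes "admissible r0" "admissible r1"
  shows "(INF n. int n - int (max (r0 n) (r1 n))) \<ge> min (INF n. int n - int (r0 n)) (INF n. int n - int (r1 n))"
proof -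
  obtain n where n: "(INF n. int n - int (max (r0 n) (r1 n))) = int n - int (max (r0 n) (r1 n))"
    using admissible_INF_attained(2)[OF admissible_max[OF assms]] by auto
  have "(INF n. int n - int (r0 n)) \<le> int n - int (r0 n)"
    by (rule cINF_lower[OF admissible_INF_attained(1)[OF assms(1)]]) simp
  moreover have "(INF n. int n - int (r1 n)) \<le> int n - int (r1 n)"
    by (rule cINF_lower[OF admissible_INF_attained(1)[OF assms(2)]]) simp
  ultimately show ?thesis unfolding n by (simp add: max_def min_def)
qed

lemma subspace_J_space_bounded: "cfun.subspace (J_space_bounded k m)"
proof (rule cfun.subspaceI)
  show "0 \<in> J_space_bounded k m" by (simp add: J_space_bounded_def J_space_zero)
next
  fix f g assume f: "f \<in> J_space_bounded k m" and g: "g \<in> J_space_bounded k m"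
  show "f + g \<in> J_space_bounded k m"
  \<comment> \<open>A zero function may belong to the space by the separate disjunct alone, without
    any \<open>r0\<close> that satisfies the inequality.\<close>
  proof (cases "f = 0 \<or> g = 0")
    case True
    then show ?thesis using f g by auto
  next
    case False
    obtain r0 where r0: "admissible r0" "has_expansion k f r0"
      "real_of_int (INF n. int n - int (r0 n)) + real_of_int k / 8 \<ge> - real_of_int m"
      using f False unfolding J_space_bounded_def by blast
    obtain r1 where r1: "admissible r1" "has_expansion k g r1"
      "real_of_int (INF n. int n - int (r1 n)) + real_of_int k / 8 \<ge> - real_of_int m"
      using g False unfolding J_space_bounded_def by blast
    let ?r = "\<lambda>n. max (r0 n) (r1 n)"
    have "real_of_int (INF n. int n - int (?r n)) \<ge>
        real_of_int (min (INF n. int n - int (r0 n)) (INF n. int n - int (r1 n)))"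
      unfolding of_int_le_iff by (rule INF_max_ge[OF r0(1) r1(1)])
    then have "real_of_int (INF n. int n - int (?r n)) + real_of_int k / 8 \<ge> - real_of_int m"
      using r0(3) r1(3) unfolding min_def by (auto split: if_splits)
    moreover have "f + g \<in> J_space k"
      using f g by (intro J_space_add) (auto simp: J_space_bounded_def)
    ultimately show ?thesis
      using admissible_max[OF r0(1) r1(1)] has_expansion_add[OF r0(2) r1(2)]
      unfolding J_space_bounded_def by blast
  qed
next
  fix x :: complex and f assume f: "f \<in> J_space_bounded k m"
  then have "fun_scale x f \<in> J_space k" by (auto simp: J_space_bounded_def J_space_scale)
  moreover have "fun_scale x f = 0" if "f = 0" using that by (simp add: fun_scale_def fun_eq_iff)
  ultimately show "fun_scale x f \<in> J_space_bounded k m"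
    using f has_expansion_scale unfolding J_space_bounded_def by blast
qed

text \<open>The multiple of \<open>f\<close> is chosen to cancel the K-th Taylor coefficient at
  \<i>; the difference then vanishes identically.\<close>

lemma J_space_one_dimensional:
  assumes f: "f \<in> J_space (- int K)" "f \<noteq> 0" and g: "g \<in> J_space (- int K)"
  shows "\<exists>x. g = fun_scale x f"
proof -
  interpret f: weak_jacobi f K by unfold_locales (rule f(1))
  interpret g: weak_jacobi g K by unfold_locales (rule g)
  have i: "\<i> \<in> upper_half_plane" by (simp add: upper_half_plane_def)
  have f_ne: "f.taylor K \<i> \<noteq> 0" using f.eq_0_if_taylor_K_eq_0 f(2) by blast
  define x where "x = g.taylor K \<i> / f.taylor K \<i>"
  define h where "h = g + fun_scale (- x) f"
  have "h \<in> J_space (- int K)" unfolding h_def by (intro J_space_add J_space_scale f(1) g)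
  then interpret h: weak_jacobi h K by unfold_locales
  have "h.taylor K \<i> = (deriv ^^ K) (\<lambda>z. g (\<i>, z) + - x * f (\<i>, z)) 0"
    unfolding h.taylor_def by (simp add: h_def fun_scale_apply)
  also have "\<dots> = g.taylor K \<i> + (deriv ^^ K) (\<lambda>z. - x * f (\<i>, z)) 0"
    unfolding g.taylor_def
    by (rule higher_deriv_add[of _ UNIV]) (auto intro!: holomorphic_on_minus holomorphic_on_mult holomorphic_on_const g.entire[OF i] f.entire[OF i])
  also have "(deriv ^^ K) (\<lambda>z. - x * f (\<i>, z)) 0 = - x * f.taylor K \<i>"
    unfolding f.taylor_def by (rule higher_deriv_cmult[OF f.entire[OF i, of UNIV]]) auto
  also have "g.taylor K \<i> + - x * f.taylor K \<i> = 0" using f_ne by (simp add: x_def)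
  finally have "h = 0" by (rule h.eq_0_if_taylor_K_eq_0)
  then have "h p = 0" for p by simp
  then have "g = fun_scale x f" by (auto simp: h_def fun_scale_def fun_eq_iff)
  then show ?thesis ..
qed

theorem theorem4p6:
  fixes k m :: int
  assumes "k < 0" and "m > 0"
  shows "cfun.subspace (J_space_bounded k m) \<and>
         (\<exists>B. finite B \<and> B \<subseteq> J_space_bounded k m \<and> cfun.span B = J_space_bounded k m)"
proof (rule conjI[OF subspace_J_space_bounded])
  show "\<exists>B. finite B \<and> B \<subseteq> J_space_bounded k m \<and> cfun.span B = J_space_bounded k m"
  \<comment> \<open>The zero space is spanned by the empty set; otherwise any nonzero element
    spans.\<close>
  proof (cases "J_space_bounded k m \<subseteq> {0}")
    case True
    moreover have "0 \<in> J_space_bounded k m" by (rule cfun.subspace_0[OF subspace_J_space_bounded])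
    ultimately show ?thesis by (intro exI[of _ "{}"]) auto
  next
    case False
    then obtain f where f: "f \<in> J_space_bounded k m" "f \<noteq> 0" by blast
    define K where "K = nat (- k)"
    have k: "k = - int K" using assms(1) by (simp add: K_def)
    have "g \<in> cfun.span {f}" if "g \<in> J_space_bounded k m" for g
    proof -
      have "f \<in> J_space (- int K)" "g \<in> J_space (- int K)"
        using f that unfolding J_space_bounded_def k by auto
      then obtain x where "g = fun_scale x f" using J_space_one_dimensional f(2) by blast
      then show ?thesis by (simp add: cfun.span_scale cfun.span_base)
    qed
    moreover have "cfun.span {f} \<subseteq> J_space_bounded k m"
      by (rule cfun.span_minimal[OF _ subspace_J_space_bounded]) (use f in auto)
    ultimately show ?thesis using f(1) by (intro exI[of _ "{f}"]) auto
  qed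
qed

end
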